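(* Let $\mathcal H$ be an infinite-dimensional separable complex Hilbert space and let $A$ be an unbounded self-adjoint operator in $\mathcal H$. Then for each positive definite self-adjoint operator $S$ such that $\mathrm{dom}\,S\cap\mathrm{dom}\,A=\{0\}$ there exists a sequence $\{S_n\}$ of positive definite self-adjoint operators possessing the properties: - $\mathrm{dom}\,S_n=\mathrm{dom}\,S\dot+\mathrm{dom}\,A$ for all $n$; - $\mathrm{clos}\{S_n\,\mathrm{dom}\,A\}\cap\mathrm{dom}\,S_n=\{0\}$ for all $n$; - $\mathrm{dom}\,S_n^2\cap\mathrm{dom}\,A=\{0\}$ for all $n$; - if $\mathfrak L_n=\mathcal H\ominus\mathrm{clos}\{S_n\,\mathrm{dom}\,A\}$, then $S=\left(S_n^{-1}P_{\mathfrak L_n}S_n^{-1}\right)^{-1/2}$ for all $n$; - for each $f\in\mathrm{dom}\,S\dot+\mathrm{dom}\,A$ the sequence $\{\|S_nf\|\}_{n=1}^\infty$ is nondecreasing; - $\mathrm{dom}\,S=\left\{f\in\mathrm{dom}\,S\dot+\mathrm{dom}\,A:\ \sup_{n\ge1}\|S_nf\|<\infty\right\}$; - $S_n\to S$ as $n\to\infty$ in the strong resolvent sense.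
   Context: $\mathrm{dom}\,T$ is the domain of a linear operator $T$, $\dot+$ denotes the direct (algebraic) sum of linear manifolds with trivial intersection, $\mathrm{clos}$ is norm closure, $S_n\,\mathrm{dom}\,A=\{S_nf:f\in\mathrm{dom}\,A\}$, and $P_{\mathfrak L}$ is the orthogonal projection onto a closed subspace $\mathfrak L$. A (possibly unbounded) self-adjoint operator $B$ is positive definite if $(Bf,f)\ge m\|f\|^2$ for all $f\in\mathrm{dom}\,B$ and some $m>0$. For a bounded nonnegative self-adjoint operator $C$ with trivial kernel, $C^{-1/2}$ is the (possibly unbounded) self-adjoint inverse of $C^{1/2}$, with domain $\mathrm{ran}\,C^{1/2}$. *)

theory Defs
  imports "HOL-Analysis.Analysis" "HOL-Library.Set_Algebras"
begin

section \<open>Complex Hilbert spaces\<close>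

class complex_vector = real_vector +
  fixes scaleC :: "complex \<Rightarrow> 'a \<Rightarrow> 'a"  (infixr "*\<^sub>C" 75)
  assumes scaleC_add_right: "a *\<^sub>C (x + y) = a *\<^sub>C x + a *\<^sub>C y"
    and scaleC_add_left: "(a + b) *\<^sub>C x = a *\<^sub>C x + b *\<^sub>C x"
    and scaleC_scaleC: "a *\<^sub>C (b *\<^sub>C x) = (a * b) *\<^sub>C x"
    and scaleC_one: "1 *\<^sub>C x = x"
    and scaleR_scaleC: "r *\<^sub>R x = complex_of_real r *\<^sub>C x"

global_interpretation complex_vector:
  vector_space "scaleC :: complex \<Rightarrow> 'a \<Rightarrow> 'a::complex_vector"
  by unfold_locales (fact scaleC_add_right scaleC_add_left scaleC_scaleC scaleC_one)+

text \<open>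
  The inner product is linear in the first argument and conjugate-linear in the second.
  Norm, metric and topology come from the class \<open>real_inner\<close>, whose real inner product is the
  real part of the complex one; hence \<open>norm x ^ 2 = Re (cinner x x)\<close>, and
  \<open>cinner x x\<close> is real by conjugate symmetry.
\<close>
class complex_inner = complex_vector + real_inner +
  fixes cinner :: "'a \<Rightarrow> 'a \<Rightarrow> complex"
  assumes cinner_commute: "cinner x y = cnj (cinner y x)"
    and cinner_add_left: "cinner (x + y) z = cinner x z + cinner y z"
    and cinner_scaleC_left: "cinner (a *\<^sub>C x) y = a * cinner x y"
    and inner_eq_Re_cinner: "inner x y = Re (cinner x y)"

class complex_hilbert = complex_inner + complete_space

definition infinite_dimensional :: "'a::complex_vector itself \<Rightarrow> bool" where
  "infinite_dimensional _ \<longleftrightarrow> \<not> (\<exists>B::'a set. finite B \<and> complex_vector.span B = UNIV)"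

definition orthocomplement :: "'a::complex_inner set \<Rightarrow> 'a set" where
  "orthocomplement M = {x. \<forall>y\<in>M. cinner x y = 0}"


section \<open>Operators with a domain\<close>

text \<open>
  An operator is a partial function. Its domain is \<open>dom T\<close>, its range is \<open>ran T\<close>, the product
  \<open>T \<circ>\<^sub>m R\<close> has its natural domain \<open>{f \<in> dom R. R f \<in> dom T}\<close>, and equality of
  operators includes equality of the domains.
\<close>
type_synonym 'a operator = "'a \<rightharpoonup> 'a"

abbreviation op_app :: "'a operator \<Rightarrow> 'a \<Rightarrow> 'a"  (infixl "\<cdot>" 90) where
  "T \<cdot> f \<equiv> the (T f)"

definition linear_operator :: "'a::complex_vector operator \<Rightarrow> bool" where
  "linear_operator T \<longleftrightarrow> complex_vector.subspace (dom T)
     \<and> (\<forall>f\<in>dom T. \<forall>g\<in>dom T. T \<cdot> (f + g) = T \<cdot> f + T \<cdot> g)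
     \<and> (\<forall>a. \<forall>f\<in>dom T. T \<cdot> (a *\<^sub>C f) = a *\<^sub>C (T \<cdot> f))"

definition bounded_operator :: "'a::complex_inner operator \<Rightarrow> bool" where
  "bounded_operator T \<longleftrightarrow> (\<exists>c. \<forall>f\<in>dom T. norm (T \<cdot> f) \<le> c * norm f)"

text \<open>The vector \<open>h\<close> below is unique when \<open>dom T\<close> is dense, which is the only case used.\<close>
definition adjoint_operator :: "'a::complex_inner operator \<Rightarrow> 'a operator" where
  "adjoint_operator T = (\<lambda>g.
     if \<exists>h. \<forall>f\<in>dom T. cinner (T \<cdot> f) g = cinner f h
     then Some (THE h. \<forall>f\<in>dom T. cinner (T \<cdot> f) g = cinner f h) else None)"

definition selfadjoint_operator :: "'a::complex_inner operator \<Rightarrow> bool" where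
  "selfadjoint_operator T \<longleftrightarrow>
     linear_operator T \<and> closure (dom T) = UNIV \<and> adjoint_operator T = T"

text \<open>
  For self-adjoint \<open>B\<close> the number \<open>cinner (B \<cdot> f) f\<close> is real, so taking the real part in the
  next two definitions is harmless.
\<close>
definition nonneg_selfadjoint :: "'a::complex_inner operator \<Rightarrow> bool" where
  "nonneg_selfadjoint B \<longleftrightarrow>
     selfadjoint_operator B \<and> (\<forall>f\<in>dom B. 0 \<le> Re (cinner (B \<cdot> f) f))"

definition posdef_selfadjoint :: "'a::complex_inner operator \<Rightarrow> bool" where
  "posdef_selfadjoint B \<longleftrightarrow> selfadjoint_operator B
     \<and> (\<exists>m>0. \<forall>f\<in>dom B. m * (norm f)\<^sup>2 \<le> Re (cinner (B \<cdot> f) f))"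

text \<open>The algebraic inverse, with domain \<open>ran T\<close> when \<open>T\<close> is injective.\<close>
definition inverse_operator :: "'a operator \<Rightarrow> 'a operator" where
  "inverse_operator T = (\<lambda>g.
     if \<exists>!f. T f = Some g then Some (THE f. T f = Some g) else None)"

text \<open>The everywhere defined orthogonal projection onto a closed subspace \<open>L\<close>.\<close>
definition orthogonal_projection :: "'a::complex_inner set \<Rightarrow> 'a operator" where
  "orthogonal_projection L = (\<lambda>x. Some (THE p. p \<in> L \<and> x - p \<in> orthocomplement L))"

text \<open>
  Every nonnegative self-adjoint operator has exactly one nonnegative self-adjoint square root;
  if \<open>C\<close> is bounded and everywhere defined, then so is the root.
\<close>
definition sqrt_operator :: "'a::complex_inner operator \<Rightarrow> 'a operator" where
  "sqrt_operator C = (THE D. nonneg_selfadjoint D \<and> D \<circ>\<^sub>m D = C)"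

definition inverse_sqrt_operator :: "'a::complex_inner operator \<Rightarrow> 'a operator" where
  "inverse_sqrt_operator C = inverse_operator (sqrt_operator C)"

text \<open>The resolvent \<open>(T - z I)\<^sup>-\<^sup>1\<close>.\<close>
definition resolvent :: "'a::complex_vector operator \<Rightarrow> complex \<Rightarrow> 'a operator" where
  "resolvent T z = inverse_operator (\<lambda>f. map_option (\<lambda>g. g - z *\<^sub>C f) (T f))"

text \<open>
  For self-adjoint operators and nonreal \<open>z\<close> the resolvents are everywhere defined.
\<close>
definition strong_resolvent_convergence ::
    "(nat \<Rightarrow> 'a::complex_inner operator) \<Rightarrow> 'a operator \<Rightarrow> bool" where
  "strong_resolvent_convergence T S \<longleftrightarrow>
     (\<forall>z. Im z \<noteq> 0 \<longrightarrow> (\<forall>f. (\<lambda>n. resolvent (T n) z \<cdot> f) \<longlonglongrightarrow> resolvent S z \<cdot> f))"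

end

theory Submission
  imports Defs
begin

text \<open>
  Put \<open>B = S\<^sup>-\<^sup>1\<close> and \<open>C = (A - \<i>)\<^sup>-\<^sup>1\<close>, so that \<open>ran B = dom S\<close> and
  \<open>ran C = dom A\<close>, and let \<open>S\<^sub>n\<close> be the inverse of the positive square root \<open>T\<^sub>n\<close> of
  \<open>B\<^sup>2 + C\<^sub>n C\<^sub>n*\<close>, where \<open>C\<^sub>n\<close> is \<open>C\<close> divided by \<open>sqrt (n + 1)\<close>. The map
  \<open>T\<^sub>n h \<mapsto> (B h, C\<^sub>n* h)\<close> is isometric, and its range is dense because the ranges of \<open>B\<close> and
  \<open>C\<close> meet only in \<open>0\<close>; it therefore extends to a unitary operator from \<open>H\<close> onto \<open>H \<times> H\<close>
  which carries \<open>S\<^sub>n (B u + C\<^sub>n v)\<close> to \<open>(u, v)\<close>. Hence \<open>S\<^sub>n dom A\<close> corresponds to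
  \<open>0 \<times> H\<close> and is closed, \<open>T\<^sub>n P T\<^sub>n = B\<^sup>2\<close> for the projection \<open>P\<close> onto its complement, and
  the square of the norm of \<open>S\<^sub>n (B u + C v)\<close> is that of \<open>u\<close> plus \<open>n + 1\<close> times that of
  \<open>v\<close>. Finally \<open>T\<^sub>n \<longlonglongrightarrow> B\<close> in norm, since the square root is norm continuous.
\<close>

section \<open>Complex inner product spaces\<close>

text \<open>The parallelogram law for \<open>z - x\<close> and \<open>z - y\<close>, solved for the
  term in \<open>x - y\<close>. It forces sequences that minimise the distance to \<open>z\<close>
  to be Cauchy.\<close>

lemma parallelogram_midpoint:
  fixes x y z :: "'a::real_inner"
  shows "(norm (x - y))\<^sup>2 = 2 * (norm (z - x))\<^sup>2 + 2 * (norm (z - y))\<^sup>2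
    - 4 * (norm (z - (1/2) *\<^sub>R (x + y)))\<^sup>2"
  unfolding power2_norm_eq_inner
  by (simp add: inner_diff_left inner_diff_right inner_add_left inner_add_right
      inner_commute[of y x] inner_commute[of z x] inner_commute[of z y])
    (simp add: field_simps)

text \<open>A minimising sequence for the distance from \<open>z\<close> to \<open>M\<close>
  converges to a point \<open>p\<close> of the closure; \<open>z - p\<close> is orthogonal to
  \<open>M\<close>, so \<open>z = p\<close>. The real inner product is used because the lemma is
  also applied to \<open>'a \<times> 'a\<close> as a real space.\<close>

lemma dense_subspace_if_orthogonal_trivial:
  fixes M :: "'a::{real_inner,complete_space} set"
  assumes M: "subspace M" and triv: "\<And>x. (\<forall>y\<in>M. inner x y = 0) \<Longrightarrow> x = 0"
  shows "closure M = UNIV"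
proof -
  have "z \<in> closure M" for z
  proof -
    define d where "d = infdist z M"
    have ne: "M \<noteq> {}" using subspace_0[OF M] by auto
    have d0: "0 \<le> d" by (simp add: d_def infdist_nonneg)
    have d_le: "d \<le> norm (z - y)" if "y \<in> M" for y
      using infdist_le[OF that, of z] by (simp add: d_def dist_norm)
    have "\<exists>y\<in>M. norm (z - y) < d + 1 / (real k + 1)" for k
    proof -
      have "Inf (dist z ` M) < d + 1 / (real k + 1)"
        using ne by (simp add: d_def infdist_def add_pos_nonneg)
      then show ?thesis
        using cInf_lessD[of "dist z ` M"] ne by (auto simp: dist_norm)
    qed
    then obtain y where yM: "\<And>k. y k \<in> M" and y: "\<And>k. norm (z - y k) < d + 1 / (real k + 1)"
      by metis
    have bound: "(norm (y m - y n))\<^sup>2 \<le> 4 * (2 * d + 1) / (real N + 1)"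
      if "N \<le> m" "N \<le> n" for m n N
    proof -
      define e where "e = 1 / (real N + 1)"
      have e: "0 \<le> e" "e \<le> 1" by (auto simp: e_def)
      have le: "norm (z - y k) \<le> d + e" if "N \<le> k" for k
      proof -
        have "1 / (real k + 1) \<le> e" using that by (auto simp: e_def field_simps)
        then show ?thesis using y[of k] by linarith
      qed
      have sq: "(norm (z - y k))\<^sup>2 \<le> (d + e)\<^sup>2" if "N \<le> k" for k
        using le[OF that] by (intro power_mono) auto
      have "(1/2) *\<^sub>R (y m + y n) \<in> M"
        by (intro subspace_scale[OF M] subspace_add[OF M] yM)
      from d_le[OF this] have mid: "d\<^sup>2 \<le> (norm (z - (1/2) *\<^sub>R (y m + y n)))\<^sup>2"
        using d0 by (intro power_mono) auto
      have "(norm (y m - y n))\<^sup>2 = 2 * (norm (z - y m))\<^sup>2 + 2 * (norm (z - y n))\<^sup>2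
          - 4 * (norm (z - (1/2) *\<^sub>R (y m + y n)))\<^sup>2"
        by (rule parallelogram_midpoint)
      also have "\<dots> \<le> 4 * (d + e)\<^sup>2 - 4 * d\<^sup>2"
        using sq[OF that(1)] sq[OF that(2)] mid by linarith
      also have "\<dots> = 4 * e * (2 * d + e)" by (simp add: power2_eq_square algebra_simps)
      also have "\<dots> \<le> 4 * e * (2 * d + 1)"
        using e by (intro mult_left_mono) auto
      finally show ?thesis by (simp add: e_def)
    qed
    have "Cauchy y"
    proof (rule metric_CauchyI)
      fix r :: real assume r: "0 < r"
      obtain N where N: "4 * (2 * d + 1) / r\<^sup>2 < real N" using reals_Archimedean2 by blast
      then have "4 * (2 * d + 1) < r\<^sup>2 * (real N + 1)"
        using r by (simp add: field_simps) (smt (verit) zero_less_power)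
      then have "4 * (2 * d + 1) / (real N + 1) < r\<^sup>2"
        by (simp add: field_simps)
      then have "norm (y m - y n) < r" if "N \<le> m" "N \<le> n" for m n
        using bound[OF that] r by (intro power2_less_imp_less[of _ r]) auto
      then show "\<exists>N. \<forall>m\<ge>N. \<forall>n\<ge>N. dist (y m) (y n) < r"
        by (auto simp: dist_norm)
    qed
    then obtain p where p: "y \<longlonglongrightarrow> p" using Cauchy_convergent_iff convergent_def by blast
    have pM: "p \<in> closure M" using p yM closure_sequential by blast
    have lim: "(\<lambda>k. d + 1 / (real k + 1)) \<longlonglongrightarrow> d"
      using tendsto_add[OF tendsto_const LIMSEQ_inverse_real_of_nat, of d]
      by (simp add: inverse_eq_divide add.commute)
    have "norm (z - p) \<le> d"
      by (rule LIMSEQ_le[OF tendsto_norm[OF tendsto_diff[OF tendsto_const p]] lim])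
        (use y in \<open>blast intro: less_imp_le\<close>)
    have "M \<subseteq> {q. d \<le> norm (z - q)}" using d_le by auto
    then have "closure M \<subseteq> {q. d \<le> norm (z - q)}"
      by (rule closure_minimal) (intro closed_Collect_le continuous_intros)
    then have far: "norm (z - p) \<le> norm (z - q)" if "q \<in> closure M" for q
      using that \<open>norm (z - p) \<le> d\<close> by fastforce
    have "inner (z - p) x = 0" if "x \<in> M" for x
    proof (rule ccontr)
      assume nz: "inner (z - p) x \<noteq> 0"
      then have xx: "0 < inner x x" by auto
      \<comment> \<open>The coefficient of the projection of \<open>z - p\<close> onto
        \<open>x\<close>: moving \<open>p\<close> by \<open>t *\<^sub>R x\<close> would lower the
        squared distance by \<open>t * inner (z - p) x\<close>, which is positive.\<close>
      define t where "t = inner (z - p) x / inner x x"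
      have "p + t *\<^sub>R x \<in> closure M"
        unfolding closure_sequential
        by (intro exI[of _ "\<lambda>k. y k + t *\<^sub>R x"] conjI allI tendsto_intros p
            subspace_add[OF M] subspace_scale[OF M] yM that)
      from far[OF this] have "(norm (z - p))\<^sup>2 \<le> (norm (z - p - t *\<^sub>R x))\<^sup>2"
        by (intro power_mono) (auto simp: algebra_simps)
      also have "\<dots> = (norm (z - p))\<^sup>2 - 2 * t * inner (z - p) x + t\<^sup>2 * inner x x"
        using dot_norm_neg[of "z - p" "t *\<^sub>R x"]
        by (simp add: power_mult_distrib dot_square_norm mult.assoc)
      also have "t\<^sup>2 * inner x x = t * inner (z - p) x"
        using xx by (simp add: t_def power2_eq_square)
      finally have "t * inner (z - p) x \<le> 0" by linarith
      moreover have "t * inner (z - p) x = (inner (z - p) x)\<^sup>2 / inner x x"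
        by (simp add: t_def power2_eq_square)
      ultimately show False using nz xx
        by (metis divide_pos_pos not_le zero_less_power2)
    qed
    then have "z - p = 0" using triv by blast
    then show ?thesis using pM by simp
  qed
  then show ?thesis by auto
qed

section \<open>Algebra and continuity of the complex inner product\<close>

lemma cinner_add_right: "cinner x (y + z) = cinner x y + cinner x z"
  by (metis cinner_add_left cinner_commute complex_cnj_add)

lemma cinner_scaleC_right: "cinner x (a *\<^sub>C y) = cnj a * cinner x y"
  by (metis cinner_scaleC_left cinner_commute complex_cnj_mult)

lemma cinner_scaleR_left: "cinner (r *\<^sub>R x) y = r *\<^sub>R cinner x y"
  by (simp add: scaleR_scaleC cinner_scaleC_left scaleR_conv_of_real)

lemma cinner_scaleR_right: "cinner x (r *\<^sub>R y) = r *\<^sub>R cinner x y"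
  by (simp add: scaleR_scaleC cinner_scaleC_right scaleR_conv_of_real)

lemma Re_cinner: "Re (cinner x y) = inner x y"
  by (simp add: inner_eq_Re_cinner)

lemma Im_cinner: "Im (cinner x y) = - inner (\<i> *\<^sub>C x) y"
  by (simp add: inner_eq_Re_cinner cinner_scaleC_left)

lemma cinner_same: "cinner x x = complex_of_real ((norm x)\<^sup>2)"
proof (rule complex_eqI)
  show "Im (cinner x x) = Im (complex_of_real ((norm x)\<^sup>2))"
    using arg_cong[OF cinner_commute[of x x], of Im] by simp
qed (simp add: Re_cinner power2_norm_eq_inner)

lemma norm_scaleC: "norm (a *\<^sub>C x) = cmod a * norm (x::'a::complex_inner)"
proof -
  have "complex_of_real ((norm (a *\<^sub>C x))\<^sup>2) = complex_of_real ((cmod a * norm x)\<^sup>2)"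
    unfolding cinner_same[symmetric]
    by (simp add: cinner_scaleC_left cinner_scaleC_right cinner_same[of x] power_mult_distrib
        complex_norm_square del: of_real_power)
  then show ?thesis
    by (simp only: of_real_eq_iff power2_eq_iff_nonneg norm_ge_zero mult_nonneg_nonneg)
qed

text \<open>Real and imaginary parts are estimated separately by the real Cauchy-Schwarz inequality;
  the resulting constant \<open>2\<close> suffices for continuity.\<close>

interpretation cinner: bounded_bilinear cinner
proof
  show "\<exists>K. \<forall>x y. cmod (cinner x y) \<le> norm x * norm y * K"
  proof (intro exI allI)
    fix x y
    have "cmod (cinner x y) \<le> \<bar>Re (cinner x y)\<bar> + \<bar>Im (cinner x y)\<bar>"
      by (rule cmod_le)
    also have "\<dots> \<le> norm x * norm y + norm (\<i> *\<^sub>C x) * norm y"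
      unfolding Re_cinner Im_cinner abs_minus_cancel by (intro add_mono Cauchy_Schwarz_ineq2)
    also have "\<dots> = norm x * norm y * 2" by (simp add: norm_scaleC)
    finally show "cmod (cinner x y) \<le> norm x * norm y * 2" .
  qed
qed (auto simp: cinner_add_left cinner_add_right cinner_scaleR_left cinner_scaleR_right)

interpretation scaleC: bounded_bilinear "scaleC :: complex \<Rightarrow> 'a \<Rightarrow> 'a::complex_inner"
proof
  show "\<exists>K. \<forall>a (x::'a). norm (a *\<^sub>C x) \<le> norm a * norm x * K"
    by (rule exI[of _ 1]) (simp add: norm_scaleC)
qed (auto simp: scaleC_add_left scaleC_add_right scaleR_scaleC scaleC_scaleC scaleR_conv_of_real
    mult.commute)

lemma cinner_eq_0_iff: "(\<forall>y. cinner x y = 0) \<longleftrightarrow> x = 0"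
  by (metis cinner.zero_left cinner_same norm_eq_zero of_real_eq_0_iff power2_eq_iff_nonneg
      zero_eq_power2)

lemma cinner_eqI: "(\<And>y. cinner x y = cinner x' y) \<Longrightarrow> x = x'"
  using cinner_eq_0_iff[of "x - x'"] by (simp add: cinner.diff_left)

section \<open>Bounded operators and square roots\<close>

text \<open>The adjoint is carried along as a second map instead of being constructed. Linearity of
  both maps then follows from nondegeneracy of the inner product.\<close>

definition adjoint_pair :: "('a::complex_inner \<Rightarrow> 'a) \<Rightarrow> ('a \<Rightarrow> 'a) \<Rightarrow> bool" where
  "adjoint_pair C D \<longleftrightarrow> (\<forall>x y. cinner (C x) y = cinner x (D y))"

abbreviation hermitian :: "('a::complex_inner \<Rightarrow> 'a) \<Rightarrow> bool" where
  "hermitian T \<equiv> adjoint_pair T T"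

definition bounded_map :: "('a::real_normed_vector \<Rightarrow> 'a) \<Rightarrow> bool" where
  "bounded_map T \<longleftrightarrow> (\<exists>c. \<forall>x. norm (T x) \<le> c * norm x)"

definition positive_map :: "('a::complex_inner \<Rightarrow> 'a) \<Rightarrow> bool" where
  "positive_map T \<longleftrightarrow> hermitian T \<and> bounded_map T \<and> (\<forall>x. 0 \<le> inner (T x) x)"

lemma adjoint_pairD: "adjoint_pair C D \<Longrightarrow> cinner (C x) y = cinner x (D y)"
  by (simp add: adjoint_pair_def)

lemma adjoint_pair_inner: "adjoint_pair C D \<Longrightarrow> inner (C x) y = inner x (D y)"
  by (simp add: adjoint_pair_def inner_eq_Re_cinner)

lemma adjoint_pair_commute: "adjoint_pair C D \<Longrightarrow> adjoint_pair D C"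
  by (metis adjoint_pair_def cinner_commute)

lemma adjoint_pair_add: "adjoint_pair C D \<Longrightarrow> C (x + y) = C x + C y"
  by (rule cinner_eqI) (simp add: adjoint_pair_def cinner_add_left)

lemma adjoint_pair_scaleC: "adjoint_pair C D \<Longrightarrow> C (a *\<^sub>C x) = a *\<^sub>C C x"
  by (rule cinner_eqI) (simp add: adjoint_pair_def cinner_scaleC_left)

lemma adjoint_pair_scaleR: "adjoint_pair C D \<Longrightarrow> C (r *\<^sub>R x) = r *\<^sub>R C x"
  by (simp add: scaleR_scaleC adjoint_pair_scaleC)

lemma adjoint_pair_diff: "adjoint_pair C D \<Longrightarrow> C (x - y) = C x - C y"
  by (rule cinner_eqI) (simp add: adjoint_pair_def cinner.diff_left)

lemma adjoint_pair_0: "adjoint_pair C D \<Longrightarrow> C 0 = 0"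
  using adjoint_pair_diff[of C D 0 0] by simp

lemma bounded_mapE:
  assumes "bounded_map T"
  obtains c where "0 < c" "\<And>x. norm (T x) \<le> c * norm x"
proof -
  obtain c where c: "\<And>x. norm (T x) \<le> c * norm x" using assms by (auto simp: bounded_map_def)
  have "norm (T x) \<le> (\<bar>c\<bar> + 1) * norm x" for x
    by (rule order_trans[OF c]) (auto intro: mult_right_mono)
  then show ?thesis by (intro that[of "\<bar>c\<bar> + 1"]) auto
qed

lemma bounded_linear_adjoint_pair:
  "adjoint_pair C D \<Longrightarrow> bounded_map C \<Longrightarrow> bounded_linear C"
  by (erule bounded_mapE, rule bounded_linear_intro)
    (auto simp: adjoint_pair_add adjoint_pair_scaleR mult.commute[of "norm _"])

text \<open>Polarization: with \<open>y\<close> the multiple of \<open>E x\<close> that has the norm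
  of \<open>x\<close>, the form at \<open>x + y\<close> minus the form at \<open>x - y\<close> is
  \<open>4 * inner (E x) y\<close>, and the parallelogram law bounds it by
  \<open>4 * w * (norm x)\<^sup>2\<close>.\<close>

lemma hermitian_bound_of_form:
  assumes E: "hermitian E" and w: "\<And>x. \<bar>inner (E x) x\<bar> \<le> w * (norm x)\<^sup>2"
  shows "norm (E x) \<le> w * norm x"
proof (cases "E x = 0")
  case True
  show ?thesis
  proof (cases "x = 0")
    case False
    have "0 \<le> w * (norm x)\<^sup>2" using w[of x] by linarith
    then show ?thesis using True False by (simp add: zero_le_mult_iff)
  qed (simp add: adjoint_pair_0[OF E])
next
  case False
  then have x: "x \<noteq> 0" using adjoint_pair_0[OF E] by auto
  define y where "y = (norm x / norm (E x)) *\<^sub>R E x"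
  have ny: "norm y = norm x" using False by (simp add: y_def)
  have ixy: "inner (E x) y = norm x * norm (E x)"
    using False by (simp add: y_def power2_norm_eq_inner[symmetric] power2_eq_square)
  have "4 * inner (E x) y = inner (E (x + y)) (x + y) - inner (E (x - y)) (x - y)"
    using adjoint_pair_inner[OF E, of y x]
    by (simp add: adjoint_pair_add[OF E] adjoint_pair_diff[OF E] inner_simps inner_commute)
  also have "\<dots> \<le> w * (norm (x + y))\<^sup>2 + w * (norm (x - y))\<^sup>2"
    using w[of "x + y"] w[of "x - y"] by linarith
  also have "\<dots> = w * (2 * (norm x)\<^sup>2 + 2 * (norm y)\<^sup>2)"
    by (simp add: power2_norm_eq_inner inner_simps inner_commute algebra_simps)
  also have "\<dots> = 4 * (w * norm x * norm x)" by (simp add: ny power2_eq_square)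
  finally show ?thesis using x by (simp add: ixy mult.commute)
qed

lemma adjoint_pair_scaleR_map: "adjoint_pair C D \<Longrightarrow> adjoint_pair (\<lambda>x. r *\<^sub>R C x) (\<lambda>x. r *\<^sub>R D x)"
  by (simp add: adjoint_pair_def cinner_scaleR_left cinner_scaleR_right)

lemma bounded_map_compose:
  assumes "bounded_map S" "bounded_map T"
  shows "bounded_map (\<lambda>x. S (T x))"
proof -
  obtain s t where s: "0 < s" "\<And>x. norm (S x) \<le> s * norm x" and t: "\<And>x. norm (T x) \<le> t * norm x"
    using assms by (meson bounded_mapE)
  have "norm (S (T x)) \<le> (s * t) * norm x" for x
    using order_trans[OF s(2)[of "T x"] mult_left_mono[OF t[of x], of s]] s(1) by (simp add: mult.assoc)
  then show ?thesis by (auto simp: bounded_map_def)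
qed

lemma bounded_map_add:
  assumes "bounded_map S" "bounded_map T"
  shows "bounded_map (\<lambda>x. S x + T x)"
proof -
  obtain s t where s: "\<And>x. norm (S x) \<le> s * norm x" and t: "\<And>x. norm (T x) \<le> t * norm x"
    using assms by (meson bounded_mapE)
  have "norm (S x + T x) \<le> (s + t) * norm x" for x
    using norm_triangle_mono[OF s t] by (simp add: distrib_right)
  then show ?thesis by (auto simp: bounded_map_def)
qed

lemma bounded_map_scaleR: "bounded_map T \<Longrightarrow> bounded_map (\<lambda>x. r *\<^sub>R T x)"
  using bounded_map_compose[of "\<lambda>x. r *\<^sub>R x" T] by (auto simp: bounded_map_def)

lemma positive_mapD:
  assumes "positive_map T"
  shows "hermitian T" "bounded_map T" "0 \<le> inner (T x) x"
  using assms by (auto simp: positive_map_def)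

section \<open>Existence of positive square roots\<close>

fun sqrt_iterate :: "('a::real_vector \<Rightarrow> 'a) \<Rightarrow> nat \<Rightarrow> 'a \<Rightarrow> 'a" where
  "sqrt_iterate X 0 x = 0"
| "sqrt_iterate X (Suc n) x = (1/2) *\<^sub>R (X x + sqrt_iterate X n (sqrt_iterate X n x))"


primrec sqrt_bound :: "nat \<Rightarrow> real" where
  "sqrt_bound 0 = 0"
| "sqrt_bound (Suc n) = (1 + (sqrt_bound n)\<^sup>2) / 2"

lemma sqrt_bound_range: "0 \<le> sqrt_bound n \<and> sqrt_bound n \<le> 1"
  by (induction n) (auto simp: power_le_one)

text \<open>Each increment is half the square of \<open>1 - sqrt_bound n\<close>, so the sequence
  increases, and it never exceeds \<open>1\<close>.\<close>

lemma sqrt_bound_convergent: "convergent sqrt_bound"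
proof (rule Bseq_monoseq_convergent)
  show "Bseq sqrt_bound"
    by (rule BseqI'[of _ 1]) (use sqrt_bound_range in auto)
  have "sqrt_bound n \<le> sqrt_bound (Suc n)" for n
    using zero_le_power2[of "1 - sqrt_bound n"] by (simp add: power2_eq_square algebra_simps)
  then show "monoseq sqrt_bound" by (simp add: mono_iff_le_Suc monoseq_Suc)
qed

text \<open>With \<open>X = 1 - K\<close>, the iteration \<open>Y \<mapsto> (X + Y\<^sup>2) / 2\<close> started at \<open>0\<close> converges to
  \<open>1 - sqrt K\<close>. Each increment is dominated in norm by the corresponding increment of the
  same iteration for \<open>X = 1\<close> in the reals.\<close>
lemma contraction_sqrt_exists:
  fixes K :: "'a::complex_hilbert \<Rightarrow> 'a"
  assumes K: "hermitian K" and K0: "\<And>x. 0 \<le> inner (K x) x" and K1: "\<And>x. inner (K x) x \<le> (norm x)\<^sup>2"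
  shows "\<exists>T. positive_map T \<and> (\<forall>x. T (T x) = K x)"
proof -
  define X where "X x = x - K x" for x
  define Y where "Y = sqrt_iterate X"
  let ?y = sqrt_bound
  have X: "hermitian X"
    using K by (simp add: X_def adjoint_pair_def cinner.diff_left cinner.diff_right)
  have X1: "norm (X x) \<le> norm x" for x
  proof -
    have "\<bar>inner (X x) x\<bar> \<le> 1 * (norm x)\<^sup>2" for x
      using K0[of x] K1[of x] by (simp add: X_def inner_diff_left power2_norm_eq_inner)
    from hermitian_bound_of_form[OF X this] show ?thesis by simp
  qed
  have Y: "hermitian (Y n)" for n
  proof (induction n)
    case (Suc n)
    then show ?case using X
      by (simp add: Y_def adjoint_pair_def cinner_scaleR_left cinner_scaleR_right
          cinner_add_left cinner_add_right)
  qed (simp add: Y_def adjoint_pair_def cinner.zero_left cinner.zero_right)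
  have Yb: "norm (Y n x) \<le> ?y n * norm x" for n x
  proof (induction n arbitrary: x)
    case (Suc n)
    have "norm (Y n (Y n x)) \<le> ?y n * norm (Y n x)" by (rule Suc)
    also have "\<dots> \<le> ?y n * (?y n * norm x)"
      using sqrt_bound_range Suc by (intro mult_left_mono) auto
    finally have "norm (X x + Y n (Y n x)) \<le> norm x + ?y n * (?y n * norm x)"
      by (rule norm_triangle_mono[OF X1])
    moreover have "norm (Y (Suc n) x) = (1/2) * norm (X x + Y n (Y n x))"
      by (simp add: Y_def del: scaleR_add_right)
    ultimately show ?case by (simp add: power2_eq_square field_simps)
  qed (simp add: Y_def)
  have Y1: "norm (Y n x) \<le> norm x" for n x
    using order_trans[OF Yb[of n x] mult_right_mono[of "?y n" 1 "norm x"]] sqrt_bound_range by simp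
  have step: "norm (Y (Suc n) x - Y n x) \<le> (?y (Suc n) - ?y n) * norm x" for n x
  proof (induction n arbitrary: x)
    case 0
    then show ?case using X1[of x] by (simp add: Y_def)
  next
    case (Suc n)
    let ?Z = "\<lambda>x. Y (Suc n) x - Y n x" and ?z = "?y (Suc n) - ?y n"
    have z: "0 \<le> ?z"
      using zero_le_power2[of "1 - ?y n"] by (simp add: power2_eq_square algebra_simps)
    have "Y (Suc (Suc n)) x - Y (Suc n) x
        = (1/2) *\<^sub>R (Y (Suc n) (Y (Suc n) x) - Y n (Y n x))"
      by (simp add: Y_def scaleR_diff_right[symmetric] del: scaleR_diff_right)
    \<comment> \<open>This splitting of a difference of squares is valid whether or not the two
      iterates commute.\<close>
    also have "Y (Suc n) (Y (Suc n) x) - Y n (Y n x) = Y (Suc n) (?Z x) + ?Z (Y n x)"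
      by (simp add: adjoint_pair_diff[OF Y])
    finally have "norm (Y (Suc (Suc n)) x - Y (Suc n) x) = (1/2) * norm (Y (Suc n) (?Z x) + ?Z (Y n x))"
      by simp
    also have "\<dots> \<le> (1/2) * (?y (Suc n) * (?z * norm x) + ?z * (?y n * norm x))"
    proof (intro mult_left_mono norm_triangle_mono)
      show "norm (Y (Suc n) (?Z x)) \<le> ?y (Suc n) * (?z * norm x)"
        using sqrt_bound_range by (intro order_trans[OF Yb] mult_left_mono Suc) auto
      show "norm (?Z (Y n x)) \<le> ?z * (?y n * norm x)"
        using z by (intro order_trans[OF Suc] mult_left_mono Yb)
    qed simp
    also have "\<dots> = (((?y (Suc n))\<^sup>2 - (?y n)\<^sup>2) / 2) * norm x"
      by (simp add: power2_eq_square field_simps)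
    also have "((?y (Suc n))\<^sup>2 - (?y n)\<^sup>2) / 2 = ?y (Suc (Suc n)) - ?y (Suc n)"
      by (simp only: sqrt_bound.simps(2)) (simp add: field_simps)
    finally show ?case .
  qed
  have diff: "norm (Y (n + k) x - Y n x) \<le> (?y (n + k) - ?y n) * norm x" for n k x
  proof (induction k)
    case (Suc k)
    have "norm (Y (n + Suc k) x - Y n x) \<le> norm (Y (Suc (n + k)) x - Y (n + k) x) + norm (Y (n + k) x - Y n x)"
      using norm_triangle_ineq[of "Y (Suc (n + k)) x - Y (n + k) x" "Y (n + k) x - Y n x"] by simp
    also have "\<dots> \<le> (?y (Suc (n + k)) - ?y (n + k)) * norm x + (?y (n + k) - ?y n) * norm x"
      by (rule add_mono[OF step Suc])
    also have "\<dots> = (?y (n + Suc k) - ?y n) * norm x" by (simp add: algebra_simps)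
    finally show ?case .
  qed simp
  have "convergent (\<lambda>n. Y n x)" for x
  proof -
    have "Cauchy (\<lambda>n. ?y n * norm x)"
      using sqrt_bound_convergent
      by (intro convergent_Cauchy) (auto simp: convergent_def intro!: tendsto_mult_right)
    then have "Cauchy (\<lambda>n. Y n x)"
      unfolding Cauchy_altdef2
    proof (intro allI impI)
      fix e :: real assume y: "\<forall>e>0. \<exists>N. \<forall>n\<ge>N. dist (?y n * norm x) (?y N * norm x) < e" and "0 < e"
      then obtain N where N: "\<forall>n\<ge>N. dist (?y n * norm x) (?y N * norm x) < e" by blast
      have "dist (Y n x) (Y N x) < e" if "N \<le> n" for n
      proof -
        have "norm (Y n x - Y N x) \<le> \<bar>?y n * norm x - ?y N * norm x\<bar>"
          using diff[of N "n - N" x] that by (simp add: left_diff_distrib)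
        then show ?thesis using N that by (fastforce simp: dist_norm)
      qed
      then show "\<exists>N. \<forall>n\<ge>N. dist (Y n x) (Y N x) < e" by blast
    qed
    then show ?thesis by (rule Cauchy_convergent)
  qed
  then obtain Z where Z: "\<And>x. (\<lambda>n. Y n x) \<longlonglongrightarrow> Z x" unfolding convergent_def by metis
  have Zh: "hermitian Z"
    unfolding adjoint_pair_def
  proof (intro allI)
    fix x y
    have "(\<lambda>n. cinner (Y n x) y) \<longlonglongrightarrow> cinner (Z x) y" by (intro cinner.tendsto Z tendsto_const)
    moreover have "(\<lambda>n. cinner x (Y n y)) \<longlonglongrightarrow> cinner x (Z y)" by (intro cinner.tendsto Z tendsto_const)
    ultimately show "cinner (Z x) y = cinner x (Z y)"
      using Y by (simp add: adjoint_pair_def LIMSEQ_unique)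
  qed
  have Z1: "norm (Z x) \<le> norm x" for x
    using Y1 by (intro LIMSEQ_le_const2[OF tendsto_norm[OF Z]]) auto
  have YY: "(\<lambda>n. Y n (Y n x)) \<longlonglongrightarrow> Z (Z x)" for x
  proof -
    \<comment> \<open>All \<open>Y n\<close> are contractions, so replacing the inner
      \<open>Y n x\<close> by its limit costs an error tending to \<open>0\<close>.\<close>
    have "(\<lambda>n. Y n (Y n x - Z x)) \<longlonglongrightarrow> 0"
      by (rule Lim_null_comparison[of _ "\<lambda>n. norm (Y n x - Z x)"])
        (use Y1 Z[of x] in \<open>auto simp: LIM_zero_iff tendsto_norm_zero_iff\<close>)
    from tendsto_add[OF this Z[of "Z x"]] show ?thesis by (simp add: adjoint_pair_diff[OF Y])
  qed
  have "Z x = (1/2) *\<^sub>R (X x + Z (Z x))" for x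
  proof (rule LIMSEQ_unique)
    show "(\<lambda>n. Y (Suc n) x) \<longlonglongrightarrow> Z x" by (rule LIMSEQ_Suc[OF Z])
    have "(\<lambda>n. (1/2) *\<^sub>R (X x + Y n (Y n x))) \<longlonglongrightarrow> (1/2) *\<^sub>R (X x + Z (Z x))"
      by (intro tendsto_intros YY)
    then show "(\<lambda>n. Y (Suc n) x) \<longlonglongrightarrow> (1/2) *\<^sub>R (X x + Z (Z x))"
      by (simp add: Y_def)
  qed
  then have fix2: "2 *\<^sub>R Z x = X x + Z (Z x)" for x
    by (metis (no_types, lifting) scaleR_half_double scaleR_2 scaleR_add_right)
  define T where "T x = x - Z x" for x
  have "hermitian T"
    using Zh by (simp add: T_def adjoint_pair_def cinner.diff_left cinner.diff_right)
  moreover have "bounded_map T"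
    unfolding bounded_map_def
  proof (intro exI allI)
    show "norm (T x) \<le> 2 * norm x" for x
      using norm_triangle_ineq4[of x "Z x"] Z1[of x] by (simp add: T_def)
  qed
  moreover have "0 \<le> inner (T x) x" for x
    using norm_cauchy_schwarz[of "Z x" x] mult_right_mono[OF Z1[of x], of "norm x"]
    by (simp add: T_def inner_diff_left power2_norm_eq_inner[symmetric] power2_eq_square)
  \<comment> \<open>The square of \<open>1 - Z\<close> is \<open>1 - 2 Z + Z\<^sup>2\<close>, which
    the fixed point equation turns into \<open>1 - X\<close>, that is, \<open>K\<close>.\<close>
  moreover have "T (T x) = K x" for x
    using fix2[of x] by (simp add: T_def adjoint_pair_diff[OF Zh] X_def scaleR_2 algebra_simps)
  ultimately show ?thesis by (auto simp: positive_map_def)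
qed

text \<open>Dividing \<open>K\<close> by a bound \<open>c\<close> gives a form between
  \<open>0\<close> and \<open>(norm x)\<^sup>2\<close>; the root obtained for it is multiplied by
  \<open>sqrt c\<close>.\<close>

lemma positive_sqrt_exists:
  fixes K :: "'a::complex_hilbert \<Rightarrow> 'a"
  assumes K: "positive_map K"
  obtains T where "positive_map T" "\<And>x. T (T x) = K x"
proof -
  obtain c where c: "0 < c" "\<And>x. norm (K x) \<le> c * norm x"
    using positive_mapD(2)[OF K] by (meson bounded_mapE)
  let ?K = "\<lambda>x. inverse c *\<^sub>R K x"
  have "\<exists>T. positive_map T \<and> (\<forall>x. T (T x) = ?K x)"
  proof (rule contraction_sqrt_exists)
    show "hermitian ?K" by (intro adjoint_pair_scaleR_map positive_mapD K)
    fix x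
    show "0 \<le> inner (?K x) x" using c positive_mapD(3)[OF K, of x] by simp
    have "inner (K x) x \<le> c * norm x * norm x"
      using norm_cauchy_schwarz[of "K x" x] mult_right_mono[OF c(2)[of x], of "norm x"] by simp
    then show "inner (?K x) x \<le> (norm x)\<^sup>2"
      using c by (simp add: field_simps power2_eq_square)
  qed
  then obtain T where T: "positive_map T" "\<And>x. T (T x) = ?K x" by blast
  show ?thesis
  proof (rule that[of "\<lambda>x. sqrt c *\<^sub>R T x"])
    show "positive_map (\<lambda>x. sqrt c *\<^sub>R T x)"
      using T(1) c by (simp add: positive_map_def adjoint_pair_scaleR_map bounded_map_scaleR)
    show "sqrt c *\<^sub>R T (sqrt c *\<^sub>R T x) = K x" for x
      using c by (simp add: adjoint_pair_scaleR[OF positive_mapD(1)[OF T(1)]] T(2) mult.assoc[symmetric])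
  qed
qed

section \<open>Estimates drawn from square roots\<close>

text \<open>For a root \<open>R\<close> of \<open>T\<close>, the norm of \<open>R (R x)\<close> is
  at most a constant times that of \<open>R x\<close>, whose square is the form of \<open>T\<close>.
  This will make the inverse of an injective \<open>T\<close> positive definite.\<close>

lemma positive_map_norm_bound:
  fixes T :: "'a::complex_hilbert \<Rightarrow> 'a"
  assumes T: "positive_map T"
  obtains c where "0 < c" "\<And>x. (norm (T x))\<^sup>2 \<le> c * inner (T x) x"
proof -
  obtain R where R: "positive_map R" "\<And>x. R (R x) = T x" using positive_sqrt_exists[OF T] by blast
  obtain c where c: "0 < c" "\<And>x. norm (R x) \<le> c * norm x"
    using positive_mapD(2)[OF R(1)] by (meson bounded_mapE)
  have "(norm (T x))\<^sup>2 \<le> c\<^sup>2 * inner (T x) x" for x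
  proof -
    have "(norm (R (R x)))\<^sup>2 \<le> (c * norm (R x))\<^sup>2" by (intro power_mono c) auto
    also have "\<dots> = c\<^sup>2 * inner (R x) (R x)" by (simp add: power_mult_distrib power2_norm_eq_inner)
    also have "inner (R x) (R x) = inner (R (R x)) x"
      using adjoint_pair_inner[OF positive_mapD(1)[OF R(1)]] by simp
    finally show ?thesis by (simp add: R(2))
  qed
  then show ?thesis using c by (intro that[of "c\<^sup>2"]) auto
qed

text \<open>The norm \<open>w\<close> of \<open>E = T - B\<close> is almost attained by \<open>\<bar>inner (E x) x\<bar>\<close>, where \<open>x\<close> is almost an
  eigenvector of \<open>E\<close> for \<open>\<plusminus>w\<close>; for such \<open>x\<close> the form of \<open>T\<^sup>2 - B\<^sup>2\<close> is nearly
  \<open>\<plusminus>w inner (T x + B x) x\<close>, whose modulus is at least that of \<open>w inner (E x) x\<close>.\<close>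
lemma positive_diff_le_sqrt:
  assumes T: "positive_map T" and B: "positive_map B"
    and e: "\<And>x. norm (T (T x) - B (B x)) \<le> e * norm x" and e0: "0 \<le> e"
  shows "norm (T x - B x) \<le> sqrt e * norm x"
proof -
  define E where "E x = T x - B x" for x
  note T_herm = positive_mapD(1)[OF T] and Bh = positive_mapD(1)[OF B]
  have E: "hermitian E"
    using T_herm Bh by (simp add: E_def adjoint_pair_def cinner.diff_left cinner.diff_right)
  obtain t b where t: "0 < t" "\<And>x. norm (T x) \<le> t * norm x" and b: "0 < b" "\<And>x. norm (B x) \<le> b * norm x"
    using positive_mapD(2)[OF T] positive_mapD(2)[OF B] by (meson bounded_mapE)
  \<comment> \<open>The infimum \<open>w\<close> of all form bounds is itself a form bound, and by
    \<open>hermitian_bound_of_form\<close> it also bounds the norm of \<open>E\<close>.\<close>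
  define W where "W = {w. 0 \<le> w \<and> (\<forall>x. \<bar>inner (E x) x\<bar> \<le> w * (norm x)\<^sup>2)}"
  define w where "w = Inf W"
  have "t + b \<in> W"
    unfolding W_def
  proof (intro CollectI conjI allI)
    fix x
    have "\<bar>inner (E x) x\<bar> \<le> norm (E x) * norm x" by (rule Cauchy_Schwarz_ineq2)
    also have "\<dots> \<le> (t * norm x + b * norm x) * norm x"
      using norm_triangle_ineq4[of "T x" "B x"] t(2)[of x] b(2)[of x]
      by (intro mult_right_mono) (auto simp: E_def)
    finally show "\<bar>inner (E x) x\<bar> \<le> (t + b) * (norm x)\<^sup>2"
      by (simp add: power2_eq_square algebra_simps)
  qed (use t b in simp)
  then have W: "W \<noteq> {}" "bdd_below W" by (auto simp: W_def intro: bdd_belowI)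
  have w0: "0 \<le> w" unfolding w_def using W by (intro cInf_greatest) (auto simp: W_def)
  have form: "\<bar>inner (E x) x\<bar> \<le> w * (norm x)\<^sup>2" for x
  proof (cases "x = 0")
    case False
    have "\<bar>inner (E x) x\<bar> / (norm x)\<^sup>2 \<le> w"
      unfolding w_def using W False by (intro cInf_greatest) (auto simp: W_def field_simps)
    then show ?thesis using False by (simp add: field_simps)
  qed simp
  have Ew: "norm (E x) \<le> w * norm x" for x
    by (rule hermitian_bound_of_form[OF E form])
  \<comment> \<open>The gap \<open>d\<close> says how closely \<open>x\<close> attains
    \<open>w\<close>. The eigenvector defect \<open>sqrt (2 * w * d)\<close> enters multiplied by
    the bound \<open>t + b\<close> of \<open>T + B\<close>; as \<open>d\<close> tends to
    \<open>0\<close>, the estimate becomes \<open>w\<^sup>2 \<le> e\<close>.\<close>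
  have key: "w * (w - d) \<le> e + sqrt (2 * w * d) * (t + b)" if d: "0 < d" "d \<le> w" for d
  proof -
    have "w - d \<notin> W" using cInf_lower[OF _ W(2), of "w - d"] d by (auto simp: w_def)
    then obtain x where x: "(w - d) * (norm x)\<^sup>2 < \<bar>inner (E x) x\<bar>" using d by (auto simp: W_def not_le)
    then have nx: "x \<noteq> 0" by auto
    define s where "s = sgn (inner (E x) x)"
    have s: "s * inner (E x) x = \<bar>inner (E x) x\<bar>" "\<bar>s\<bar> = 1"
    proof -
      show "s * inner (E x) x = \<bar>inner (E x) x\<bar>" by (simp add: s_def abs_sgn mult.commute)
      have "0 \<le> (w - d) * (norm x)\<^sup>2" using d by simp
      then have "inner (E x) x \<noteq> 0" using x by auto
      then show "\<bar>s\<bar> = 1" by (simp add: s_def abs_sgn_eq)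
    qed
    have s2: "s * s = 1" using s(2) by (metis abs_mult_self_eq mult_1)
    have "(norm (E x - (s * w) *\<^sub>R x))\<^sup>2 = (norm (E x))\<^sup>2 - 2 * w * (s * inner (E x) x) + w\<^sup>2 * (norm x)\<^sup>2"
    proof -
      have "(norm (E x - (s * w) *\<^sub>R x))\<^sup>2
          = (norm (E x))\<^sup>2 - 2 * inner (E x) ((s * w) *\<^sub>R x) + (norm ((s * w) *\<^sub>R x))\<^sup>2"
        using dot_norm_neg[of "E x" "(s * w) *\<^sub>R x"] by (simp add: field_simps)
      then show ?thesis using s(2) by (simp add: power_mult_distrib abs_mult)
    qed
    also have "\<dots> \<le> (w * norm x)\<^sup>2 - 2 * w * ((w - d) * (norm x)\<^sup>2) + w\<^sup>2 * (norm x)\<^sup>2"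
      unfolding s(1) using x w0 Ew[of x] by (intro add_mono diff_mono power_mono mult_left_mono) auto
    also have "\<dots> = (2 * w * d) * (norm x)\<^sup>2" by (simp add: power2_eq_square algebra_simps)
    finally have "sqrt ((norm (E x - (s * w) *\<^sub>R x))\<^sup>2) \<le> sqrt ((2 * w * d) * (norm x)\<^sup>2)"
      by (rule real_sqrt_le_mono)
    then have eig: "norm (E x - (s * w) *\<^sub>R x) \<le> sqrt (2 * w * d) * norm x"
      by (simp add: real_sqrt_mult)
    define p where "p = T x + B x"
    have p: "norm p \<le> (t + b) * norm x"
      using norm_triangle_mono[OF t(2) b(2), of x x] by (simp add: p_def distrib_right)
    \<comment> \<open>Both forms are nonnegative, so the modulus of their difference is at most
      their sum.\<close>
    have px: "(w - d) * (norm x)\<^sup>2 \<le> inner x p"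
      using x positive_mapD(3)[OF T, of x] positive_mapD(3)[OF B, of x]
      by (auto simp: p_def E_def inner_diff_left inner_add_right inner_commute[of x])
    \<comment> \<open>The left side is \<open>(norm (T x))\<^sup>2 - (norm (B x))\<^sup>2\<close>,
      which factors by symmetry of the real inner product.\<close>
    have "inner (T (T x) - B (B x)) x = inner (E x) p"
      using adjoint_pair_inner[OF T_herm, of "T x" x] adjoint_pair_inner[OF Bh, of "B x" x]
      by (simp add: E_def p_def inner_diff_left inner_add_right inner_commute[of "B x" "T x"])
    also have "\<dots> = inner (E x - (s * w) *\<^sub>R x) p + s * w * inner x p"
      by (simp add: inner_diff_left)
    finally have "s * w * inner x p = inner (T (T x) - B (B x)) x - inner (E x - (s * w) *\<^sub>R x) p"
      by simp
    moreover have "\<bar>s * w * inner x p\<bar> = w * \<bar>inner x p\<bar>" using s(2) w0 by (simp add: abs_mult)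
    moreover have "\<bar>inner (T (T x) - B (B x)) x\<bar> \<le> (e * norm x) * norm x"
      using Cauchy_Schwarz_ineq2[of "T (T x) - B (B x)" x] mult_right_mono[OF e[of x], of "norm x"] by simp
    moreover have "\<bar>inner (E x - (s * w) *\<^sub>R x) p\<bar> \<le> (sqrt (2 * w * d) * norm x) * ((t + b) * norm x)"
      using w0 d by (intro order_trans[OF Cauchy_Schwarz_ineq2] mult_mono eig p) auto
    ultimately have "w * \<bar>inner x p\<bar> \<le> (e + sqrt (2 * w * d) * (t + b)) * (norm x)\<^sup>2"
      by (simp add: power2_eq_square algebra_simps)
    moreover have "w * ((w - d) * (norm x)\<^sup>2) \<le> w * \<bar>inner x p\<bar>"
      using px w0 by (intro mult_left_mono) auto
    ultimately have "(w * (w - d)) * (norm x)\<^sup>2 \<le> (e + sqrt (2 * w * d) * (t + b)) * (norm x)\<^sup>2"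
      by simp
    then show ?thesis by (rule mult_right_le_imp_le) (use nx in simp)
  qed
  have "w\<^sup>2 \<le> e"
  proof (cases "w = 0")
    case False
    then have w: "0 < w" using w0 by simp
    have "w * (w - 0) \<le> e + sqrt (2 * w * 0) * (t + b)"
    proof (rule tendsto_le[OF trivial_limit_at_right_real[of 0]])
      show "((\<lambda>d. w * (w - d)) \<longlongrightarrow> w * (w - 0)) (at_right 0)" by (intro tendsto_intros)
      show "((\<lambda>d. e + sqrt (2 * w * d) * (t + b)) \<longlongrightarrow> e + sqrt (2 * w * 0) * (t + b)) (at_right 0)"
        by (intro tendsto_intros)
      show "\<forall>\<^sub>F d in at_right 0. w * (w - d) \<le> e + sqrt (2 * w * d) * (t + b)"
        unfolding eventually_at_right_field using w key by (intro exI[of _ w]) auto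
    qed
    then show ?thesis by (simp add: power2_eq_square)
  qed (use e0 in simp)
  then have "w \<le> sqrt e" by (rule real_le_rsqrt)
  then show ?thesis using order_trans[OF Ew[of x] mult_right_mono] by (simp add: E_def)
qed

section \<open>Self-adjoint operators\<close>

lemma complex_subspace_imp_subspace: "complex_vector.subspace M \<Longrightarrow> subspace M"
  by (simp add: complex_vector.subspace_def subspace_def scaleR_scaleC)

text \<open>The imaginary part of \<open>cinner x y\<close> is the real part of
  \<open>cinner x (\<i> *\<^sub>C y)\<close>, and a complex subspace contains
  \<open>\<i> *\<^sub>C y\<close>.\<close>

lemma cinner_eq_0_if_inner_eq_0:
  assumes "complex_vector.subspace M" "\<forall>y\<in>M. inner x y = 0" "y \<in> M"
  shows "cinner x y = 0"
proof (rule complex_eqI)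
  have "\<i> *\<^sub>C y \<in> M" using assms by (simp add: complex_vector.subspace_scale)
  then have "Re (cinner x (\<i> *\<^sub>C y)) = 0" using assms(2) by (simp add: Re_cinner)
  then show "Im (cinner x y) = Im 0" by (simp add: cinner_scaleC_right)
  show "Re (cinner x y) = Re 0" using assms by (simp add: Re_cinner)
qed

text \<open>Serves to pull Cauchy sequences back along maps that are bounded below, isometries among
  them.\<close>

lemma Cauchy_if_dominated:
  assumes "Cauchy g" "0 < c" "\<And>m n. c * dist (f m) (f n) \<le> dist (g m) (g n)"
  shows "Cauchy f"
proof (rule metric_CauchyI)
  fix e :: real assume "0 < e"
  then obtain N where N: "\<forall>m\<ge>N. \<forall>n\<ge>N. dist (g m) (g n) < c * e"
    using metric_CauchyD[OF assms(1), of "c * e"] assms(2) by auto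
  have "dist (f m) (f n) < e" if "N \<le> m" "N \<le> n" for m n
  proof -
    have "c * dist (f m) (f n) < c * e" using assms(3)[of m n] N that by fastforce
    then show ?thesis using assms(2) by simp
  qed
  then show "\<exists>N. \<forall>m\<ge>N. \<forall>n\<ge>N. dist (f m) (f n) < e" by blast
qed

section \<open>Partial inverses and adjoints\<close>

lemma inverse_operator_eq_Some_iff:
  "inverse_operator T g = Some f \<longleftrightarrow> T f = Some g \<and> (\<forall>f'. T f' = Some g \<longrightarrow> f' = f)"
proof (cases "\<exists>!f. T f = Some g")
  case True
  then obtain a where a: "T a = Some g" "\<And>b. T b = Some g \<Longrightarrow> b = a" by blast
  have "inverse_operator T g = Some a"
    using True the_equality[of "\<lambda>f. T f = Some g", OF a] by (simp add: inverse_operator_def)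
  then show ?thesis using a by (metis option.inject)
next
  case False
  then have "inverse_operator T g = None" by (simp only: inverse_operator_def if_False)
  then show ?thesis using False by auto
qed

abbreviation total_op :: "('a \<Rightarrow> 'a) \<Rightarrow> 'a operator" where
  "total_op T \<equiv> (\<lambda>x. Some (T x))"

lemma inverse_total: "inj T \<Longrightarrow> inverse_operator (total_op T) (T x) = Some x"
  by (auto simp: inverse_operator_eq_Some_iff dest: injD)

lemma dom_inverse_total: "inj T \<Longrightarrow> dom (inverse_operator (total_op T)) = range T"
  by (auto simp: dom_def inverse_operator_eq_Some_iff dest: injD)

lemma inverse_inverse_total: "inj T \<Longrightarrow> inverse_operator (inverse_operator (total_op T)) = total_op T"
  by (rule ext) (auto simp: inverse_operator_eq_Some_iff dest: injD)

lemma inj_if_kernel_trivial: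
  "adjoint_pair T R \<Longrightarrow> (\<And>x. T x = 0 \<Longrightarrow> x = 0) \<Longrightarrow> inj T"
  by (rule injI) (metis adjoint_pair_diff right_minus_eq)

text \<open>Density makes the vector unique: the difference of two candidates is orthogonal to the
  domain, hence by continuity to itself.\<close>

lemma adjoint_operator_eq_Some_iff:
  assumes "closure (dom T) = UNIV"
  shows "adjoint_operator T g = Some h \<longleftrightarrow> (\<forall>f\<in>dom T. cinner (T \<cdot> f) g = cinner f h)"
proof -
  have unique: "h = h'" if "\<forall>f\<in>dom T. cinner (T \<cdot> f) g = cinner f h"
    "\<forall>f\<in>dom T. cinner (T \<cdot> f) g = cinner f h'" for h h'
  proof -
    have "closed {f. cinner f (h - h') = 0}"
      by (intro closed_Collect_eq continuous_intros cinner.continuous_on)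
    moreover have "dom T \<subseteq> {f. cinner f (h - h') = 0}"
    proof
      fix f assume "f \<in> dom T"
      then have "cinner f h = cinner f h'" using that by metis
      then show "f \<in> {f. cinner f (h - h') = 0}" by (simp add: cinner.diff_right)
    qed
    ultimately have "cinner (h - h') (h - h') = 0"
      using closure_minimal assms by blast
    then show ?thesis by (simp add: cinner_same)
  qed
  have the: "(THE h. \<forall>f\<in>dom T. cinner (T \<cdot> f) g = cinner f h) = h"
    if "\<forall>f\<in>dom T. cinner (T \<cdot> f) g = cinner f h" for h
    by (rule the_equality, rule that, rule unique[OF _ that])
  show ?thesis
  proof (cases "\<exists>h. \<forall>f\<in>dom T. cinner (T \<cdot> f) g = cinner f h")
    case True
    then obtain k where k: "\<forall>f\<in>dom T. cinner (T \<cdot> f) g = cinner f k" by blast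
    have "adjoint_operator T g = Some k"
      by (simp only: adjoint_operator_def True if_True the[OF k])
    then show ?thesis using k unique[OF k, of h] by (metis option.inject)
  next
    case False
    then have "adjoint_operator T g = None" by (simp only: adjoint_operator_def if_False)
    then show ?thesis using False by (metis option.distinct(1))
  qed
qed

lemma linear_operatorD:
  assumes "linear_operator T"
  shows "complex_vector.subspace (dom T)"
    and "f \<in> dom T \<Longrightarrow> g \<in> dom T \<Longrightarrow> T \<cdot> (f + g) = T \<cdot> f + T \<cdot> g"
    and "f \<in> dom T \<Longrightarrow> T \<cdot> (a *\<^sub>C f) = a *\<^sub>C (T \<cdot> f)"
  using assms unfolding linear_operator_def by blast+

lemma linear_operator_diff:
  assumes "linear_operator T" "f \<in> dom T" "g \<in> dom T"
  shows "f - g \<in> dom T" "T \<cdot> (f - g) = T \<cdot> f - T \<cdot> g"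
proof -
  have neg: "(-1) *\<^sub>C g = - g" for g :: 'a using complex_vector.scale_minus_left[of 1 g] by simp
  show "f - g \<in> dom T"
    using linear_operatorD(1)[OF assms(1)] assms by (simp add: complex_vector.subspace_diff)
  have "- g \<in> dom T" "T \<cdot> (- g) = - (T \<cdot> g)"
    using linear_operatorD(3)[OF assms(1,3), of "-1"]
      complex_vector.subspace_neg[OF linear_operatorD(1)[OF assms(1)] assms(3)] by (simp_all add: neg)
  then show "T \<cdot> (f - g) = T \<cdot> f - T \<cdot> g"
    using linear_operatorD(2)[OF assms(1,2), of "- g"] by simp
qed

section \<open>Closedness, lower bounds and resolvents of self-adjoint operators\<close>

lemma selfadjoint_eq_Some_iff:
  "selfadjoint_operator A \<Longrightarrow> A g = Some h \<longleftrightarrow> (\<forall>f\<in>dom A. cinner (A \<cdot> f) g = cinner f h)"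
  by (metis adjoint_operator_eq_Some_iff selfadjoint_operator_def)

lemma selfadjoint_symmetric:
  "selfadjoint_operator A \<Longrightarrow> f \<in> dom A \<Longrightarrow> g \<in> dom A \<Longrightarrow> cinner (A \<cdot> f) g = cinner f (A \<cdot> g)"
  by (metis domIff option.collapse selfadjoint_eq_Some_iff)

text \<open>The operator is its own adjoint, and the identity that characterises the adjoint
  survives limits.\<close>

lemma selfadjoint_closed:
  assumes A: "selfadjoint_operator A" and f: "\<And>k. f k \<in> dom A" "f \<longlonglongrightarrow> g"
    and h: "(\<lambda>k. A \<cdot> f k) \<longlonglongrightarrow> h"
  shows "A g = Some h"
  unfolding selfadjoint_eq_Some_iff[OF A]
proof
  fix a assume a: "a \<in> dom A"
  have "(\<lambda>k. cinner (A \<cdot> a) (f k)) \<longlonglongrightarrow> cinner (A \<cdot> a) g"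
    by (intro cinner.tendsto tendsto_const f)
  moreover have "(\<lambda>k. cinner a (A \<cdot> f k)) \<longlonglongrightarrow> cinner a h"
    by (intro cinner.tendsto tendsto_const h)
  ultimately show "cinner (A \<cdot> a) g = cinner a h"
    using selfadjoint_symmetric[OF A a f(1)] by (simp add: LIMSEQ_unique)
qed

text \<open>The range is dense, since a vector \<open>x\<close> orthogonal to it satisfies
  \<open>A x = Some (cnj z *\<^sub>C x)\<close>, which the second bound allows only for
  \<open>x = 0\<close>. It is closed by the first bound and closedness of \<open>A\<close>. Stating
  both bounds covers nonreal \<open>z\<close> as well as \<open>z = 0\<close> for positive definite
  operators.\<close>

lemma selfadjoint_shift_surj:
  fixes A :: "'a::complex_hilbert operator"
  assumes A: "selfadjoint_operator A" and c: "0 < c"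
    and bound: "\<And>f. f \<in> dom A \<Longrightarrow> c * norm f \<le> norm (A \<cdot> f - z *\<^sub>C f)"
    and bound': "\<And>f. f \<in> dom A \<Longrightarrow> c * norm f \<le> norm (A \<cdot> f - cnj z *\<^sub>C f)"
  shows "\<exists>f\<in>dom A. A \<cdot> f - z *\<^sub>C f = h"
proof -
  have lin: "linear_operator A" using A by (simp add: selfadjoint_operator_def)
  define Q where "Q f = A \<cdot> f - z *\<^sub>C f" for f
  define M where "M = Q ` dom A"
  have add: "Q f + Q g = Q (f + g)" if "f \<in> dom A" "g \<in> dom A" for f g
    using linear_operatorD(2)[OF lin that] by (simp add: Q_def scaleC_add_right)
  have scale: "a *\<^sub>C Q f = Q (a *\<^sub>C f)" if "f \<in> dom A" for a f
    using linear_operatorD(3)[OF lin that]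
    by (simp add: Q_def scaleC.diff_right scaleC_scaleC mult.commute)
  have diff: "Q f - Q g = Q (f - g)" if "f \<in> dom A" "g \<in> dom A" for f g
    using linear_operator_diff[OF lin that] by (simp add: Q_def scaleC.diff_right)
  note sub = linear_operatorD(1)[OF lin]
  have M: "complex_vector.subspace M"
  proof (rule complex_vector.subspaceI)
    have z: "0 \<in> dom A" by (rule complex_vector.subspace_0[OF sub])
    then have "Q 0 = 0" using diff[OF z z] by simp
    then show "0 \<in> M" using z unfolding M_def by force
    show "x + y \<in> M" if xy: "x \<in> M" "y \<in> M" for x y
    proof -
      obtain f g where f: "f \<in> dom A" "x = Q f" and g: "g \<in> dom A" "y = Q g"
        using xy unfolding M_def by blast
      show ?thesis
        unfolding f(2) g(2) add[OF f(1) g(1)] M_def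
        by (rule imageI) (rule complex_vector.subspace_add[OF sub f(1) g(1)])
    qed
    show "a *\<^sub>C x \<in> M" if x: "x \<in> M" for a x
    proof -
      obtain f where f: "f \<in> dom A" "x = Q f" using x unfolding M_def by blast
      show ?thesis
        unfolding f(2) scale[OF f(1)] M_def
        by (rule imageI) (rule complex_vector.subspace_scale[OF sub f(1)])
    qed
  qed
  have "closure M = UNIV"
  proof (rule dense_subspace_if_orthogonal_trivial)
    show "subspace M" by (rule complex_subspace_imp_subspace[OF M])
    fix x assume "\<forall>y\<in>M. inner x y = 0"
    then have "cinner x (Q f) = 0" if "f \<in> dom A" for f
      using cinner_eq_0_if_inner_eq_0[OF M] that by (auto simp: M_def)
    then have "cinner (Q f) x = 0" if "f \<in> dom A" for f
      using that cinner_commute[of "Q f" x] by simp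
    then have "\<forall>f\<in>dom A. cinner (A \<cdot> f) x = cinner f (cnj z *\<^sub>C x)"
      by (simp add: Q_def cinner.diff_left cinner_scaleC_left cinner_scaleC_right)
    then have "A x = Some (cnj z *\<^sub>C x)" by (simp add: selfadjoint_eq_Some_iff[OF A])
    then have "c * norm x \<le> 0" using bound'[of x] by auto
    then show "x = 0" using c by (simp add: mult_le_0_iff)
  qed
  then obtain g where "\<And>k. g k \<in> M" and g: "g \<longlonglongrightarrow> h"
    using closure_sequential[of h M] by auto
  then have "\<forall>k. \<exists>f. f \<in> dom A \<and> g k = Q f" unfolding M_def image_iff by blast
  then obtain f where f: "\<And>k. f k \<in> dom A" "\<And>k. g k = Q (f k)" by metis
  have "Cauchy f"
  proof (rule Cauchy_if_dominated[OF LIMSEQ_imp_Cauchy[OF g] c])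
    fix m n
    show "c * dist (f m) (f n) \<le> dist (g m) (g n)"
      using bound[OF linear_operator_diff(1)[OF lin f(1) f(1)], of m n] diff[OF f(1) f(1), of m n]
      by (simp add: f(2) dist_norm Q_def)
  qed
  then obtain a where a: "f \<longlonglongrightarrow> a" using Cauchy_convergent_iff convergent_def by blast
  have "(\<lambda>k. g k + z *\<^sub>C f k) \<longlonglongrightarrow> h + z *\<^sub>C a"
    by (intro tendsto_add g scaleC.tendsto tendsto_const a)
  then have "(\<lambda>k. A \<cdot> f k) \<longlonglongrightarrow> h + z *\<^sub>C a" by (simp add: f(2) Q_def)
  from selfadjoint_closed[OF A f(1) a this] have "A a = Some (h + z *\<^sub>C a)" .
  then show ?thesis by (intro bexI[of _ a]) auto
qed

text \<open>Since \<open>cinner (A \<cdot> f) f\<close> is real, pairing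
  \<open>A \<cdot> f - z *\<^sub>C f\<close> with \<open>f\<close> has imaginary part
  \<open>- Im z * (norm f)\<^sup>2\<close>; Cauchy-Schwarz does the rest.\<close>

lemma selfadjoint_nonreal_bound:
  assumes A: "selfadjoint_operator A" and f: "f \<in> dom A"
  shows "\<bar>Im z\<bar> * norm f \<le> norm (A \<cdot> f - z *\<^sub>C f)"
proof (cases "f = 0")
  case False
  have "cinner (A \<cdot> f) f = cnj (cinner (A \<cdot> f) f)"
    using selfadjoint_symmetric[OF A f f] cinner_commute[of f "A \<cdot> f"] by simp
  then have "Im (cinner (A \<cdot> f) f) = 0" by (simp add: complex_eq_iff)
  then have "Im (cinner (A \<cdot> f - z *\<^sub>C f) f) = - (Im z * (norm f)\<^sup>2)"
    by (simp add: cinner.diff_left cinner_scaleC_left cinner_same)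
  then have "\<bar>Im z\<bar> * (norm f)\<^sup>2 = \<bar>inner (\<i> *\<^sub>C (A \<cdot> f - z *\<^sub>C f)) f\<bar>"
    by (simp add: Im_cinner abs_mult)
  also have "\<dots> \<le> norm (\<i> *\<^sub>C (A \<cdot> f - z *\<^sub>C f)) * norm f" by (rule Cauchy_Schwarz_ineq2)
  finally have "\<bar>Im z\<bar> * norm f * norm f \<le> norm (A \<cdot> f - z *\<^sub>C f) * norm f"
    by (simp add: norm_scaleC power2_eq_square)
  then show ?thesis using False by simp
qed simp

lemma selfadjoint_nonreal_surj:
  fixes A :: "'a::complex_hilbert operator"
  assumes A: "selfadjoint_operator A" and z: "Im z \<noteq> 0"
  shows "\<exists>f\<in>dom A. A \<cdot> f - z *\<^sub>C f = h"
  using selfadjoint_nonreal_bound[OF A, of _ z] selfadjoint_nonreal_bound[OF A, of _ "cnj z"] z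
  by (intro selfadjoint_shift_surj[OF A, of "\<bar>Im z\<bar>"]) auto

lemma selfadjoint_nonreal_inj:
  assumes A: "selfadjoint_operator A" and z: "Im z \<noteq> 0" and fg: "f \<in> dom A" "g \<in> dom A"
    and eq: "A \<cdot> f - z *\<^sub>C f = A \<cdot> g - z *\<^sub>C g"
  shows "f = g"
proof -
  have lin: "linear_operator A" using A by (simp add: selfadjoint_operator_def)
  have "A \<cdot> (f - g) - z *\<^sub>C (f - g) = (A \<cdot> f - z *\<^sub>C f) - (A \<cdot> g - z *\<^sub>C g)"
    by (simp add: linear_operator_diff(2)[OF lin fg] scaleC.diff_right)
  then have "A \<cdot> (f - g) - z *\<^sub>C (f - g) = 0" using eq by simp
  then have "\<bar>Im z\<bar> * norm (f - g) \<le> 0"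
    using selfadjoint_nonreal_bound[OF A linear_operator_diff(1)[OF lin fg], of z] by simp
  then show ?thesis using z by (simp add: mult_le_0_iff)
qed

lemma resolvent_eqI:
  assumes A: "selfadjoint_operator A" and z: "Im z \<noteq> 0" and f: "A f = Some (h + z *\<^sub>C f)"
  shows "resolvent A z \<cdot> h = f"
proof -
  have "resolvent A z h = Some f"
    unfolding resolvent_def inverse_operator_eq_Some_iff
  proof (intro conjI allI impI)
    show "map_option (\<lambda>g. g - z *\<^sub>C f) (A f) = Some h" using f by simp
    fix f' assume "map_option (\<lambda>g. g - z *\<^sub>C f') (A f') = Some h"
    then obtain g where g: "A f' = Some g" "g - z *\<^sub>C f' = h" by auto
    show "f' = f"
      by (rule selfadjoint_nonreal_inj[OF A z]) (use f g in auto)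
  qed
  then show ?thesis by simp
qed

lemma resolvent_solves:
  fixes A :: "'a::complex_hilbert operator"
  assumes A: "selfadjoint_operator A" and z: "Im z \<noteq> 0"
  shows "A (resolvent A z \<cdot> h) = Some (h + z *\<^sub>C (resolvent A z \<cdot> h))"
proof -
  obtain f where "f \<in> dom A" "A \<cdot> f - z *\<^sub>C f = h" using selfadjoint_nonreal_surj[OF A z] by blast
  then have "A f = Some (h + z *\<^sub>C f)" by auto
  with resolvent_eqI[OF A z this] show ?thesis by simp
qed

section \<open>Passage between self-adjoint operators and bounded maps\<close>

text \<open>A vector orthogonal to the range of \<open>T\<close> is annihilated by \<open>T\<close>,
  so the range is dense. On \<open>T x\<close> the adjoint relation reads
  \<open>cinner x g = cinner x (T h)\<close>, which means \<open>g = T h\<close>.\<close>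

lemma selfadjoint_inverse_total:
  fixes T :: "'a::complex_hilbert \<Rightarrow> 'a"
  assumes T: "hermitian T" and inj: "inj T"
  shows "selfadjoint_operator (inverse_operator (total_op T))"
proof -
  let ?S = "inverse_operator (total_op T)"
  note dom = dom_inverse_total[OF inj] and app = inverse_total[OF inj]
  have sub: "complex_vector.subspace (range T)"
  proof (rule complex_vector.subspaceI)
    show "0 \<in> range T" using adjoint_pair_0[OF T] by (metis rangeI)
    show "x + y \<in> range T" if "x \<in> range T" "y \<in> range T" for x y
      using that by (auto simp: adjoint_pair_add[OF T, symmetric])
    show "a *\<^sub>C x \<in> range T" if "x \<in> range T" for a x
      using that by (auto simp: adjoint_pair_scaleC[OF T, symmetric])
  qed
  have dense: "closure (dom ?S) = UNIV"
    unfolding dom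
  proof (rule dense_subspace_if_orthogonal_trivial)
    show "subspace (range T)" by (rule complex_subspace_imp_subspace[OF sub])
    fix y assume "\<forall>x\<in>range T. inner y x = 0"
    then have "inner (T y) (T y) = 0" using adjoint_pair_inner[OF T, of y "T y"] by simp
    then have "T y = T 0" using adjoint_pair_0[OF T] by simp
    then show "y = 0" using inj by (simp add: injD)
  qed
  have "linear_operator ?S"
    unfolding linear_operator_def dom
    using sub app by (auto simp: adjoint_pair_add[OF T, symmetric] adjoint_pair_scaleC[OF T, symmetric])
  moreover have "adjoint_operator ?S = ?S"
  proof
    fix g
    have "adjoint_operator ?S g = Some h \<longleftrightarrow> ?S g = Some h" for h
    proof -
      have "adjoint_operator ?S g = Some h \<longleftrightarrow> (\<forall>x. cinner x g = cinner x (T h))"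
        unfolding adjoint_operator_eq_Some_iff[OF dense] dom
        by (simp add: app adjoint_pairD[OF T])
      also have "\<dots> \<longleftrightarrow> g = T h" by (metis cinner_commute cinner_eqI)
      also have "\<dots> \<longleftrightarrow> ?S g = Some h"
        using app by (auto simp: inverse_operator_eq_Some_iff)
      finally show ?thesis .
    qed
    then show "adjoint_operator ?S g = ?S g" by (metis not_Some_eq)
  qed
  ultimately show ?thesis using dense by (simp add: selfadjoint_operator_def)
qed

text \<open>At \<open>T x\<close> the form of the inverse is \<open>inner x (T x)\<close>, so the
  lower bound is that of \<open>positive_map_norm_bound\<close>.\<close>

lemma posdef_inverse_total:
  fixes T :: "'a::complex_hilbert \<Rightarrow> 'a"
  assumes T: "positive_map T" and inj: "inj T"
  shows "posdef_selfadjoint (inverse_operator (total_op T))"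
proof -
  obtain c where c: "0 < c" "\<And>x. (norm (T x))\<^sup>2 \<le> c * inner (T x) x"
    using positive_map_norm_bound[OF T] by blast
  have "inverse c * (norm (T x))\<^sup>2 \<le> inner x (T x)" for x
    using c(2)[of x] c(1) by (simp add: field_simps inner_commute)
  then show ?thesis
    unfolding posdef_selfadjoint_def dom_inverse_total[OF inj]
    using selfadjoint_inverse_total[OF positive_mapD(1)[OF T] inj] c(1)
    by (auto simp: inverse_total[OF inj] Re_cinner intro!: exI[of _ "inverse c"])
qed

text \<open>At \<open>z = 0\<close> positive definiteness supplies both bounds of
  \<open>selfadjoint_shift_surj\<close>. The everywhere defined inverse \<open>B\<close> lets the
  construction work with bounded maps.\<close>

lemma posdef_obtain_inverse:
  fixes S :: "'a::complex_hilbert operator"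
  assumes S: "posdef_selfadjoint S"
  obtains B where "positive_map B" "inj B" "S = inverse_operator (total_op B)"
proof -
  obtain m where A: "selfadjoint_operator S" and m: "0 < m"
    and pos: "\<And>f. f \<in> dom S \<Longrightarrow> m * (norm f)\<^sup>2 \<le> inner (S \<cdot> f) f"
    using S by (auto simp: posdef_selfadjoint_def Re_cinner)
  have lin: "linear_operator S" using A by (simp add: selfadjoint_operator_def)
  have bound: "m * norm f \<le> norm (S \<cdot> f)" if "f \<in> dom S" for f
  proof (cases "f = 0")
    case False
    have "m * norm f * norm f \<le> norm (S \<cdot> f) * norm f"
      using pos[OF that] norm_cauchy_schwarz[of "S \<cdot> f" f] by (simp add: power2_eq_square)
    then show ?thesis using False by simp
  qed simp
  have "\<exists>f\<in>dom S. S \<cdot> f - 0 *\<^sub>C f = h" for h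
    by (rule selfadjoint_shift_surj[OF A m]) (use bound in auto)
  then obtain B where B: "\<And>h. B h \<in> dom S" "\<And>h. S \<cdot> B h = h" by simp metis
  have SB: "S (B h) = Some h" for h using B[of h] by auto
  have eq: "f = B h" if "S f = Some h" for f h
  proof -
    have f: "f \<in> dom S" using that by auto
    have "m * norm (f - B h) \<le> 0"
      using bound[OF linear_operator_diff(1)[OF lin f B(1)], of h]
        linear_operator_diff(2)[OF lin f B(1), of h] that B(2)[of h] by simp
    then show ?thesis using m by (simp add: mult_le_0_iff)
  qed
  have inj: "inj B" by (metis B(2) injI)
  show ?thesis
  proof (rule that[OF _ inj])
    have "hermitian B"
      unfolding adjoint_pair_def using selfadjoint_symmetric[OF A B(1) B(1)] by (simp add: B(2))
    moreover have "bounded_map B"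
      unfolding bounded_map_def
    proof (intro exI allI)
      show "norm (B h) \<le> inverse m * norm h" for h
        using bound[OF B(1), of h] m by (simp add: B(2) field_simps)
    qed
    moreover have "0 \<le> inner (B h) h" for h
      using pos[OF B(1), of h] m by (simp add: B(2) inner_commute order_trans[rotated])
    ultimately show "positive_map B" by (simp add: positive_map_def)
    show "S = inverse_operator (total_op B)"
    proof
      fix f
      have "S f = Some h \<longleftrightarrow> f = B h" for h using eq SB by blast
      moreover have "inverse_operator (total_op B) f = Some h \<longleftrightarrow> f = B h" for h
        by (auto simp: inverse_operator_eq_Some_iff dest: injD[OF inj])
      ultimately have "S f = Some h \<longleftrightarrow> inverse_operator (total_op B) f = Some h" for h by simp
      then show "S f = inverse_operator (total_op B) f" by (metis not_Some_eq)
    qed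
  qed
qed

text \<open>The resolvents at \<open>\<i>\<close> and \<open>-\<i>\<close> are adjoint to each other
  and serve as \<open>C\<close> and \<open>D\<close>.\<close>

lemma selfadjoint_domain_eq_range:
  fixes A :: "'a::complex_hilbert operator"
  assumes A: "selfadjoint_operator A"
  obtains C D where "adjoint_pair C D" "bounded_map C" "bounded_map D" "inj C" "range C = dom A"
proof -
  obtain C where C: "\<And>h. C h \<in> dom A" "\<And>h. A \<cdot> C h - \<i> *\<^sub>C C h = h"
    using selfadjoint_nonreal_surj[OF A, of \<i>] by simp metis
  obtain D where D: "\<And>h. D h \<in> dom A" "\<And>h. A \<cdot> D h - (-\<i>) *\<^sub>C D h = h"
    using selfadjoint_nonreal_surj[OF A, of "-\<i>"] by (simp del: complex_vector.scale_minus_left) metis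
  show ?thesis
  proof
    show "adjoint_pair C D"
      unfolding adjoint_pair_def
    proof (intro allI)
      fix x y
      have "cinner (C x) y = cinner (C x) (A \<cdot> D y - (-\<i>) *\<^sub>C D y)" by (simp only: D)
      also have "\<dots> = cinner (A \<cdot> C x - \<i> *\<^sub>C C x) (D y)"
        using selfadjoint_symmetric[OF A C(1) D(1), of x y]
        by (simp only: cinner.diff_left cinner.diff_right cinner_scaleC_left cinner_scaleC_right) simp
      finally show "cinner (C x) y = cinner x (D y)" by (simp only: C)
    qed
    show "bounded_map C"
      unfolding bounded_map_def
      using selfadjoint_nonreal_bound[OF A C(1), of \<i>] by (intro exI[of _ 1]) (simp add: C)
    show "bounded_map D"
      unfolding bounded_map_def
      using selfadjoint_nonreal_bound[OF A D(1), of "-\<i>"] unfolding D(2) by (intro exI[of _ 1]) simp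
    show "inj C" by (metis C(2) injI)
    have "f \<in> range C" if "f \<in> dom A" for f
    proof -
      have "f = C (A \<cdot> f - \<i> *\<^sub>C f)"
        by (rule selfadjoint_nonreal_inj[OF A, of \<i>]) (use that C in simp_all)
      then show ?thesis by blast
    qed
    then show "range C = dom A" using C(1) by blast
  qed
qed

lemma nonneg_selfadjoint_total:
  assumes "positive_map B"
  shows "nonneg_selfadjoint (total_op B)"
proof -
  note B = positive_mapD[OF assms]
  have dense: "closure (dom (total_op B)) = UNIV" by (simp add: dom_def)
  have "adjoint_operator (total_op B) = total_op B"
  proof
    fix g show "adjoint_operator (total_op B) g = total_op B g"
      by (simp add: adjoint_operator_eq_Some_iff[OF dense] adjoint_pairD[OF B(1)])
  qed
  moreover have "linear_operator (total_op B)"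
    by (simp add: linear_operator_def dom_def adjoint_pair_add[OF B(1)] adjoint_pair_scaleC[OF B(1)])
  ultimately show ?thesis
    using dense B(3) by (simp add: nonneg_selfadjoint_def selfadjoint_operator_def Re_cinner)
qed

text \<open>A competing root \<open>D\<close> is total because \<open>D \<circ>\<^sub>m D\<close>
  is, and bounded because the squared norm of \<open>D \<cdot> x\<close> is the form of
  \<open>D \<circ>\<^sub>m D\<close>. Then \<open>positive_diff_le_sqrt\<close> with
  \<open>e = 0\<close> identifies it with \<open>B\<close>.\<close>

lemma sqrt_operator_total:
  fixes B :: "'a::complex_hilbert \<Rightarrow> 'a"
  assumes B: "positive_map B"
  shows "sqrt_operator (total_op (\<lambda>x. B (B x))) = total_op B"
  unfolding sqrt_operator_def
proof (rule the_equality)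
  show "nonneg_selfadjoint (total_op B) \<and> total_op B \<circ>\<^sub>m total_op B = total_op (\<lambda>x. B (B x))"
    using nonneg_selfadjoint_total[OF B] by (auto simp: map_comp_def)
next
  fix D assume D: "nonneg_selfadjoint D \<and> D \<circ>\<^sub>m D = total_op (\<lambda>x. B (B x))"
  then have A: "selfadjoint_operator D" and nn: "\<And>f. f \<in> dom D \<Longrightarrow> 0 \<le> inner (D \<cdot> f) f"
    by (auto simp: nonneg_selfadjoint_def Re_cinner)
  define R where "R x = D \<cdot> x" for x
  have comp: "(D \<circ>\<^sub>m D) x = Some (B (B x))" for x using D by simp
  have DR: "D x = Some (R x)" for x
    using comp[of x] by (cases "D x") (auto simp: R_def)
  have RR: "R (R x) = B (B x)" for x
    using comp[of x] by (simp add: DR)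
  have dom: "x \<in> dom D" for x using DR by auto
  have Rh: "hermitian R"
    using selfadjoint_symmetric[OF A dom dom] by (simp add: adjoint_pair_def R_def)
  obtain c where c: "0 < c" "\<And>x. norm (B (B x)) \<le> c * norm x"
    using bounded_map_compose[OF positive_mapD(2)[OF B] positive_mapD(2)[OF B]]
    by (meson bounded_mapE)
  have "norm (R x) \<le> sqrt c * norm x" for x
  proof (rule power2_le_imp_le)
    have "(norm (R x))\<^sup>2 = inner (B (B x)) x"
      using adjoint_pair_inner[OF Rh, of "R x" x] by (simp add: RR power2_norm_eq_inner)
    also have "\<dots> \<le> c * (norm x)\<^sup>2"
      using norm_cauchy_schwarz[of "B (B x)" x] mult_right_mono[OF c(2)[of x], of "norm x"]
      by (simp add: power2_eq_square)
    finally show "(norm (R x))\<^sup>2 \<le> (sqrt c * norm x)\<^sup>2"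
      using c(1) by (simp add: power_mult_distrib)
  qed (use c in simp)
  then have "positive_map R"
    using Rh nn[OF dom] by (auto simp: positive_map_def bounded_map_def R_def)
  from positive_diff_le_sqrt[OF this B, of 0] have "R x = B x" for x by (simp add: RR)
  then show "D = total_op B" by (simp add: DR fun_eq_iff)
qed

text \<open>For the limit resolvent vector \<open>g = B (f + z *\<^sub>C g)\<close>, the vectors
  \<open>k n = T n (f + z *\<^sub>C g)\<close> tend to \<open>g\<close> and lie in the domain of the
  \<open>n\<close>-th operator. That operator minus \<open>z\<close> maps \<open>k n - r n\<close>
  to \<open>z *\<^sub>C (g - k n)\<close>, so the nonreal bound applies.\<close>

lemma strong_resolvent_convergence_inverse:
  fixes T :: "nat \<Rightarrow> 'a::complex_hilbert \<Rightarrow> 'a"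
  assumes T: "\<And>n. hermitian (T n)" "\<And>n. inj (T n)" and B: "hermitian B" "inj B"
    and lim: "\<And>x. (\<lambda>n. T n x) \<longlonglongrightarrow> B x"
  shows "strong_resolvent_convergence (\<lambda>n. inverse_operator (total_op (T n))) (inverse_operator (total_op B))"
  unfolding strong_resolvent_convergence_def
proof (intro allI impI)
  fix z f assume z: "Im z \<noteq> 0"
  let ?S = "inverse_operator (total_op B)" and ?Sn = "\<lambda>n. inverse_operator (total_op (T n))"
  note SA = selfadjoint_inverse_total[OF T] and SB = selfadjoint_inverse_total[OF B]
  define g where "g = resolvent ?S z \<cdot> f"
  define r where "r n = resolvent (?Sn n) z \<cdot> f" for n
  define k where "k n = T n (f + z *\<^sub>C g)" for n
  have "?S g = Some (f + z *\<^sub>C g)" unfolding g_def by (rule resolvent_solves[OF SB z])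
  then have "B (f + z *\<^sub>C g) = g" by (simp add: inverse_operator_eq_Some_iff)
  then have kg: "k \<longlonglongrightarrow> g" using lim[of "f + z *\<^sub>C g"] by (simp add: k_def[abs_def])
  have bound: "\<bar>Im z\<bar> * norm (k n - r n) \<le> cmod z * norm (g - k n)" for n
  proof -
    have lin: "linear_operator (?Sn n)" using SA by (simp add: selfadjoint_operator_def)
    have r: "?Sn n (r n) = Some (f + z *\<^sub>C r n)" unfolding r_def by (rule resolvent_solves[OF SA z])
    have k: "?Sn n (k n) = Some (f + z *\<^sub>C g)" unfolding k_def by (rule inverse_total[OF T(2)])
    have dom: "k n \<in> dom (?Sn n)" "r n \<in> dom (?Sn n)" using r k by auto
    have "?Sn n \<cdot> (k n - r n) - z *\<^sub>C (k n - r n) = z *\<^sub>C (g - k n)"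
      unfolding linear_operator_diff(2)[OF lin dom] by (simp add: r k scaleC.diff_right)
    then show ?thesis
      using selfadjoint_nonreal_bound[OF SA linear_operator_diff(1)[OF lin dom], of z]
      by (simp add: norm_scaleC)
  qed
  have "(\<lambda>n. k n - r n) \<longlonglongrightarrow> 0"
  proof (rule Lim_null_comparison[of _ "\<lambda>n. cmod z / \<bar>Im z\<bar> * norm (g - k n)"])
    show "\<forall>\<^sub>F n in sequentially. norm (k n - r n) \<le> cmod z / \<bar>Im z\<bar> * norm (g - k n)"
      using bound z by (simp add: field_simps)
    have "(\<lambda>n. cmod z / \<bar>Im z\<bar> * norm (g - k n)) \<longlonglongrightarrow> cmod z / \<bar>Im z\<bar> * norm (g - g)"
      by (intro tendsto_intros kg)
    then show "(\<lambda>n. cmod z / \<bar>Im z\<bar> * norm (g - k n)) \<longlonglongrightarrow> 0" by simp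
  qed
  from tendsto_diff[OF kg this] show "(\<lambda>n. resolvent (?Sn n) z \<cdot> f) \<longlonglongrightarrow> resolvent ?S z \<cdot> f"
    by (simp add: r_def g_def)
qed

section \<open>Square roots of sums of squares\<close>

text \<open>The construction for a single index. The last assumption combines injectivity of
  \<open>B\<close> and \<open>C\<close> with trivial intersection of their ranges.\<close>

locale square_sum =
  fixes B C D T :: "'a::complex_hilbert \<Rightarrow> 'a"
  assumes T: "positive_map T" and B: "hermitian B" "bounded_map B"
    and CD: "adjoint_pair C D" "bounded_map C" "bounded_map D"
    and TT: "T (T x) = B (B x) + C (D x)"
    and triv: "B u + C v = 0 \<Longrightarrow> u = 0 \<and> v = 0"
begin

lemmas T_herm = positive_mapD(1)[OF T]

lemma bounded_linear_maps: "bounded_linear T" "bounded_linear B" "bounded_linear C" "bounded_linear D"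
  by (fact bounded_linear_adjoint_pair[OF T_herm positive_mapD(2)[OF T]]
    bounded_linear_adjoint_pair[OF B] bounded_linear_adjoint_pair[OF CD(1,2)]
    bounded_linear_adjoint_pair[OF adjoint_pair_commute[OF CD(1)] CD(3)])+

text \<open>The form of \<open>B\<^sup>2 + C D\<close> at \<open>h\<close> is a sum of two squares,
  so in the product norm \<open>T h \<mapsto> (B h, D h)\<close> is an isometry.\<close>

lemma norm_T: "norm (T h) = norm (B h, D h)"
proof -
  have "(norm (T h))\<^sup>2 = inner (T (T h)) h"
    using adjoint_pair_inner[OF T_herm, of "T h" h] by (simp add: power2_norm_eq_inner)
  also have "\<dots> = (norm (B h))\<^sup>2 + (norm (D h))\<^sup>2"
    unfolding TT inner_add_left
    using adjoint_pair_inner[OF B(1), of "B h" h] adjoint_pair_inner[OF CD(1), of "D h" h]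
    by (simp add: power2_norm_eq_inner)
  finally have "sqrt ((norm (T h))\<^sup>2) = norm (B h, D h)" by (simp only: norm_Pair)
  then show ?thesis by simp
qed

lemma sum_inj:
  assumes "B u + C v = B u' + C v'"
  shows "u = u' \<and> v = v'"
proof -
  have "B (u - u') + C (v - v') = (B u + C v) - (B u' + C v')"
    by (simp add: adjoint_pair_diff[OF B(1)] adjoint_pair_diff[OF CD(1)])
  with assms have "u - u' = 0 \<and> v - v' = 0" by (intro triv) simp
  then show ?thesis by simp
qed

lemma inj_T: "inj T"
proof (rule inj_if_kernel_trivial[OF T_herm])
  fix h assume "T h = 0"
  then have "B h + C 0 = 0" using norm_T[of h] by (simp add: adjoint_pair_0[OF CD(1)] zero_prod_def)
  then show "h = 0" using triv by blast
qed

text \<open>Moving \<open>B\<close> and \<open>D\<close> to the other side, orthogonality of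
  \<open>(u, v)\<close> to the range becomes \<open>B u + C v = 0\<close>.\<close>

lemma range_dense: "closure (range (\<lambda>h. (B h, D h))) = UNIV"
proof (rule dense_subspace_if_orthogonal_trivial)
  have "bounded_linear (\<lambda>h. (B h, D h))" by (intro bounded_linear_Pair bounded_linear_maps)
  then show "subspace (range (\<lambda>h. (B h, D h)))"
    by (intro linear_subspace_image subspace_UNIV) (simp add: bounded_linear.linear)
  fix p assume p: "\<forall>y\<in>range (\<lambda>h. (B h, D h)). inner p y = 0"
  obtain u v where uv: "p = (u, v)" by (cases p)
  have "inner (B u + C v) h = 0" for h
    using p adjoint_pair_inner[OF B(1), of u h] adjoint_pair_inner[OF CD(1), of v h]
    by (simp add: uv inner_add_left)
  then have "B u + C v = 0" using inner_eq_zero_iff by blast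
  then show "p = 0" using triv[of u v] by (simp add: uv zero_prod_def)
qed

lemma range_T_dense: "closure (range T) = UNIV"
proof -
  have "closure (dom (inverse_operator (total_op T))) = UNIV"
    using selfadjoint_inverse_total[OF T_herm inj_T] unfolding selfadjoint_operator_def by blast
  then show ?thesis by (simp only: dom_inverse_total[OF inj_T])
qed

text \<open>Describes the extended isometry: applying \<open>T\<close> to \<open>T (h k)\<close>
  gives \<open>B (B (h k)) + C (D (h k))\<close>, and everything is continuous.\<close>

lemma T_limit:
  assumes "(\<lambda>k. (B (h k), D (h k))) \<longlonglongrightarrow> (u, v)" and x: "(\<lambda>k. T (h k)) \<longlonglongrightarrow> x"
  shows "T x = B u + C v" and "norm x = norm (u, v)"
proof -
  have u: "(\<lambda>k. B (h k)) \<longlonglongrightarrow> u" and v: "(\<lambda>k. D (h k)) \<longlonglongrightarrow> v"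
    using tendsto_fst[OF assms(1)] tendsto_snd[OF assms(1)] by simp_all
  have "(\<lambda>k. T (T (h k))) \<longlonglongrightarrow> B u + C v"
    unfolding TT by (intro tendsto_add bounded_linear.tendsto[OF bounded_linear_maps(2)] bounded_linear.tendsto[OF bounded_linear_maps(3)] u v)
  moreover have "(\<lambda>k. T (T (h k))) \<longlonglongrightarrow> T x" by (rule bounded_linear.tendsto[OF bounded_linear_maps(1) x])
  ultimately show "T x = B u + C v" by (simp add: LIMSEQ_unique)
  have "(\<lambda>k. norm (T (h k))) \<longlonglongrightarrow> norm (u, v)" unfolding norm_T by (rule tendsto_norm[OF assms(1)])
  then show "norm x = norm (u, v)" using tendsto_norm[OF x] by (rule LIMSEQ_unique[rotated])
qed

lemma dist_T: "dist (T g) (T h) = dist (B g, D g) (B h, D h)"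
  using norm_T[of "g - h"]
  by (simp only: dist_norm diff_Pair adjoint_pair_diff[OF T_herm] adjoint_pair_diff[OF B(1)]
      adjoint_pair_diff[OF adjoint_pair_commute[OF CD(1)]])

text \<open>The extended isometry is onto the product: approximate \<open>(u, v)\<close> by pairs
  \<open>(B h, D h)\<close> and pull back.\<close>

lemma solve: "\<exists>x. T x = B u + C v \<and> norm x = norm (u, v)"
proof -
  have "(u, v) \<in> closure (range (\<lambda>h. (B h, D h)))" by (simp add: range_dense)
  then obtain p where p: "\<And>k. p k \<in> range (\<lambda>h. (B h, D h))" and lim: "p \<longlonglongrightarrow> (u, v)"
    unfolding closure_sequential by blast
  then have "\<forall>k. \<exists>h. p k = (B h, D h)" by blast
  then obtain h where h: "\<And>k. p k = (B (h k), D (h k))" by metis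
  then have p_eq: "p = (\<lambda>k. (B (h k), D (h k)))" by (rule ext)
  have "Cauchy (\<lambda>k. T (h k))"
    by (rule Cauchy_if_dominated[OF LIMSEQ_imp_Cauchy[OF lim], of 1]) (simp_all add: dist_T h)
  then obtain x where "(\<lambda>k. T (h k)) \<longlonglongrightarrow> x" using Cauchy_convergent_iff convergent_def by blast
  from T_limit[OF lim[unfolded p_eq] this] show ?thesis by blast
qed

text \<open>The opposite direction: approximate \<open>x\<close> by vectors \<open>T h\<close> and
  push forward to the product.\<close>

lemma decompose: "\<exists>u v. T x = B u + C v"
proof -
  have "x \<in> closure (range T)" by (simp add: range_T_dense)
  then obtain p where p: "\<And>k. p k \<in> range T" and lim: "p \<longlonglongrightarrow> x"
    unfolding closure_sequential by blast
  then have "\<forall>k. \<exists>h. p k = T h" by blast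
  then obtain h where h: "\<And>k. p k = T (h k)" by metis
  then have p_eq: "p = (\<lambda>k. T (h k))" by (rule ext)
  have "Cauchy (\<lambda>k. (B (h k), D (h k)))"
    by (rule Cauchy_if_dominated[OF LIMSEQ_imp_Cauchy[OF lim], of 1]) (simp_all add: dist_T[symmetric] h)
  then obtain w where "(\<lambda>k. (B (h k), D (h k))) \<longlonglongrightarrow> w"
    using Cauchy_convergent_iff convergent_def by blast
  then have "(\<lambda>k. (B (h k), D (h k))) \<longlonglongrightarrow> (fst w, snd w)" by simp
  from T_limit(1)[OF this lim[unfolded p_eq]] show ?thesis by blast
qed

section \<open>The inverse of \<open>T\<close> and its domain\<close>

definition S where "S = inverse_operator (total_op T)"

lemma S_T: "S (T x) = Some x"
  unfolding S_def by (rule inverse_total[OF inj_T])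

lemma T_S: "T (S \<cdot> (B u + C v)) = B u + C v"
proof -
  obtain x where x: "T x = B u + C v" using solve by blast
  then have "S \<cdot> (B u + C v) = x" using S_T[of x] by simp
  then show ?thesis using x by simp
qed

lemma T_S_B: "T (S \<cdot> B u) = B u" and T_S_C: "T (S \<cdot> C v) = C v"
  using T_S[of u 0] T_S[of 0 v] by (simp_all add: adjoint_pair_0[OF B(1)] adjoint_pair_0[OF CD(1)])

lemma T_eqD: "T x = T y \<Longrightarrow> x = y"
  using inj_T by (rule injD)

lemma range_T: "range T = dom S"
  by (simp add: S_def dom_inverse_total[OF inj_T])

lemma dom_S: "dom S = range B + range C"
proof -
  have "range T = range B + range C"
  proof (intro equalityI subsetI)
    fix f assume "f \<in> range T"
    then obtain x where "f = T x" by blast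
    then obtain u v where "f = B u + C v" using decompose[of x] by blast
    then show "f \<in> range B + range C" by (simp add: set_plus_intro)
  next
    fix f assume "f \<in> range B + range C"
    then obtain u v where "f = B u + C v" by (auto simp: set_plus_def)
    then show "f \<in> range T" by (intro image_eqI[of _ _ "S \<cdot> f"]) (simp_all add: T_S)
  qed
  then show ?thesis by (simp only: range_T)
qed

lemma norm_S: "(norm (S \<cdot> (B u + C v)))\<^sup>2 = (norm u)\<^sup>2 + (norm v)\<^sup>2"
proof -
  obtain x where "T x = B u + C v" "norm x = norm (u, v)" using solve by blast
  then have "S \<cdot> (B u + C v) = x" using S_T[of x] by simp
  then show ?thesis using \<open>norm x = norm (u, v)\<close> by (simp add: norm_Pair)
qed

lemma S_C_norm: "norm (S \<cdot> C v) = norm v"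
  using norm_S[of 0 v] by (simp add: adjoint_pair_0[OF B(1)])

lemma S_C_add: "S \<cdot> C v + S \<cdot> C v' = S \<cdot> C (v + v')"
  by (rule T_eqD) (simp only: adjoint_pair_add[OF T_herm] T_S_C, simp only: adjoint_pair_add[OF CD(1)])

lemma S_C_diff: "S \<cdot> C v - S \<cdot> C v' = S \<cdot> C (v - v')"
  by (rule T_eqD) (simp only: adjoint_pair_diff[OF T_herm] T_S_C, simp only: adjoint_pair_diff[OF CD(1)])

lemma S_C_scaleC: "a *\<^sub>C (S \<cdot> C v) = S \<cdot> C (a *\<^sub>C v)"
  by (rule T_eqD) (simp only: adjoint_pair_scaleC[OF T_herm] T_S_C, simp only: adjoint_pair_scaleC[OF CD(1)])

lemma S_sum: "S \<cdot> (B u + C v) = S \<cdot> B u + S \<cdot> C v"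
  by (rule T_eqD) (simp add: adjoint_pair_add[OF T_herm] T_S_C T_S_B T_S)

section \<open>The image of \<open>range C\<close> under \<open>S\<close> and the projection along
  it\<close>

text \<open>In the application \<open>range C\<close> is \<open>dom A\<close>; under the unitary
  onto the product, \<open>N\<close> becomes the second factor.\<close>

definition N where "N = (\<lambda>f. S \<cdot> f) ` range C"

lemma N_eq: "N = range (\<lambda>v. S \<cdot> C v)"
  by (auto simp: N_def)

text \<open>The map \<open>v \<mapsto> S \<cdot> C v\<close> is isometric on a complete space, so
  its range is closed.\<close>

lemma closure_N: "closure N = N"
proof (rule closure_closed)
  show "closed N"
    unfolding closed_sequential_limits
  proof (intro allI impI)
    fix x l assume *: "(\<forall>n. x n \<in> N) \<and> x \<longlonglongrightarrow> l"
    then obtain v where v: "\<And>n. x n = S \<cdot> C (v n)" unfolding N_eq image_iff by metis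
    have dist: "dist (S \<cdot> C v) (S \<cdot> C v') = dist v v'" for v v'
      by (simp add: dist_norm S_C_diff S_C_norm)
    have "Cauchy v"
      by (rule Cauchy_if_dominated[of x 1]) (use * in \<open>auto simp: v dist intro: LIMSEQ_imp_Cauchy\<close>)
    then obtain w where w: "v \<longlonglongrightarrow> w" using Cauchy_convergent_iff convergent_def by blast
    have "x \<longlonglongrightarrow> S \<cdot> C w"
      using w by (subst tendsto_dist_iff, subst (asm) tendsto_dist_iff) (simp add: v dist)
    then have "l = S \<cdot> C w" using * LIMSEQ_unique by blast
    then show "l \<in> N" by (simp add: N_eq)
  qed
qed

text \<open>If \<open>S \<cdot> C v = T h\<close>, applying \<open>T\<close> gives
  \<open>B (B h) + C (D h) = C v\<close>; comparing components yields \<open>B h = 0\<close>, hence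
  \<open>h = 0\<close>.\<close>

lemma N_inter_dom: "N \<inter> dom S = {0}"
proof
  show "N \<inter> dom S \<subseteq> {0}"
  proof
    fix x assume "x \<in> N \<inter> dom S"
    then have "x \<in> range (\<lambda>v. S \<cdot> C v)" "x \<in> range T"
      unfolding N_eq range_T by blast+
    then obtain v h where v: "x = S \<cdot> C v" and h: "x = T h" by blast
    have "B (B h) + C (D h) = B 0 + C v"
      using T_S_C[of v] v h TT[of h] by (simp add: adjoint_pair_0[OF B(1)])
    from sum_inj[OF this] have "B h + C 0 = 0" by (simp add: adjoint_pair_0[OF CD(1)])
    then have "h = 0" using triv by blast
    then show "x \<in> {0}" using h by (simp add: adjoint_pair_0[OF T_herm])
  qed
  have "S \<cdot> C 0 = 0" using S_C_norm[of 0] by simp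
  then have "0 \<in> N" unfolding N_eq by (intro image_eqI[of _ _ 0]) simp_all
  moreover have "0 \<in> dom S"
    using S_T[of 0] by (auto simp: adjoint_pair_0[OF T_herm])
  ultimately show "{0} \<subseteq> N \<inter> dom S" by simp
qed

text \<open>For \<open>f\<close> in both sets, \<open>S \<cdot> f\<close> lies in \<open>N\<close>
  and in \<open>dom S\<close>, hence is \<open>0\<close>.\<close>

lemma dom_square_inter: "dom (S \<circ>\<^sub>m S) \<inter> range C = {0}"
proof
  show "dom (S \<circ>\<^sub>m S) \<inter> range C \<subseteq> {0}"
  proof
    fix f assume f: "f \<in> dom (S \<circ>\<^sub>m S) \<inter> range C"
    then obtain x y v where x: "S f = Some x" and y: "S x = Some y" and v: "f = C v"
      by (auto simp: map_comp_def split: option.splits)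
    have "f = T x" using x by (simp add: S_def inverse_operator_eq_Some_iff)
    have "x = S \<cdot> C v" "x \<in> dom S" using x y v by auto
    then have "x \<in> N \<inter> dom S" by (simp add: N_eq)
    then have "x = 0" using N_inter_dom by blast
    then show "f \<in> {0}" using \<open>f = T x\<close> by (simp add: adjoint_pair_0[OF T_herm])
  qed
  have "S 0 = Some 0" using S_T[of 0] by (simp add: adjoint_pair_0[OF T_herm])
  then have "0 \<in> dom (S \<circ>\<^sub>m S)" by (auto simp: map_comp_def)
  moreover have "0 \<in> range C"
    by (intro image_eqI[of _ _ 0]) (simp_all add: adjoint_pair_0[OF CD(1)])
  ultimately show "{0} \<subseteq> dom (S \<circ>\<^sub>m S) \<inter> range C" by simp
qed

text \<open>By \<open>norm_S\<close> the vectors \<open>S \<cdot> B u\<close> and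
  \<open>S \<cdot> C v\<close> satisfy Pythagoras, so their real inner product vanishes;
  \<open>N\<close> being a complex subspace, so does the complex one.\<close>

lemma S_B_orthogonal: "S \<cdot> B u \<in> orthocomplement N"
proof -
  have N: "complex_vector.subspace N"
    unfolding N_eq
  proof (rule complex_vector.subspaceI)
    show "0 \<in> range (\<lambda>v. S \<cdot> C v)" using N_inter_dom by (auto simp: N_eq)
  qed (auto simp: S_C_add S_C_scaleC)
  have "inner (S \<cdot> B u) (S \<cdot> C v) = 0" for v
    using norm_S[of u v] norm_S[of u 0] norm_S[of 0 v]
      dot_norm[of "S \<cdot> B u" "S \<cdot> C v"]
    by (simp add: S_sum adjoint_pair_0[OF B(1)] adjoint_pair_0[OF CD(1)])
  then have "\<forall>y\<in>N. inner (S \<cdot> B u) y = 0" by (auto simp: N_eq)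
  then show ?thesis
    unfolding orthocomplement_def using cinner_eq_0_if_inner_eq_0[OF N] by blast
qed

text \<open>The summands lie in the orthocomplement \<open>L\<close> of \<open>N\<close> and in that
  of \<open>L\<close>. A competitor differs from the first by a vector of \<open>L\<close> that is
  orthogonal to itself.\<close>

lemma projection_S_B:
  "orthogonal_projection (orthocomplement N) (S \<cdot> B u + S \<cdot> C v) = Some (S \<cdot> B u)"
proof -
  let ?L = "orthocomplement N"
  have 1: "S \<cdot> B u + S \<cdot> C v - S \<cdot> B u \<in> orthocomplement ?L"
  proof -
    have "cinner (S \<cdot> C v) y = 0" if "y \<in> ?L" for y
    proof -
      have "cinner y (S \<cdot> C v) = 0" using that by (simp add: orthocomplement_def N_eq)
      then show ?thesis using cinner_commute[of "S \<cdot> C v" y] by simp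
    qed
    then show ?thesis by (simp add: orthocomplement_def[of ?L])
  qed
  have "p = S \<cdot> B u" if p: "p \<in> ?L" "S \<cdot> B u + S \<cdot> C v - p \<in> orthocomplement ?L" for p
  proof -
    have L: "S \<cdot> B u - p \<in> ?L"
      using p(1) S_B_orthogonal[of u] by (simp add: orthocomplement_def cinner.diff_left)
    have "cinner (S \<cdot> B u + S \<cdot> C v - p) (S \<cdot> B u - p) = 0"
      "cinner (S \<cdot> B u + S \<cdot> C v - S \<cdot> B u) (S \<cdot> B u - p) = 0"
      using p(2) 1 L by (simp_all add: orthocomplement_def[of ?L])
    then have "cinner (S \<cdot> B u - p) (S \<cdot> B u - p) = 0"
      by (simp add: cinner.diff_left cinner_add_left)
    then show ?thesis by (simp add: cinner_same)
  qed
  then show ?thesis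
    unfolding orthogonal_projection_def using 1 S_B_orthogonal by (auto intro!: the_equality)
qed

text \<open>The vector \<open>T h\<close> splits as
  \<open>S \<cdot> B (B h) + S \<cdot> C (D h)\<close>; projecting keeps the first summand, and
  \<open>T\<close> maps it to \<open>B (B h)\<close>.\<close>

lemma compression:
  "inverse_operator S \<circ>\<^sub>m orthogonal_projection (orthocomplement N) \<circ>\<^sub>m inverse_operator S
    = total_op (\<lambda>x. B (B x))"
proof
  fix h
  have "T h = S \<cdot> B (B h) + S \<cdot> C (D h)"
    by (rule T_eqD) (simp add: adjoint_pair_add[OF T_herm] T_S_B T_S_C TT)
  then have "orthogonal_projection (orthocomplement N) (T h) = Some (S \<cdot> B (B h))"
    by (simp add: projection_S_B)
  moreover have "inverse_operator S = total_op T"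
    unfolding S_def by (rule inverse_inverse_total[OF inj_T])
  ultimately show "(inverse_operator S \<circ>\<^sub>m orthogonal_projection (orthocomplement N) \<circ>\<^sub>m inverse_operator S) h
    = Some (B (B h))"
    by (simp add: map_comp_def T_S_B)
qed

end

section \<open>Choice of the sequence and verification of its properties\<close>

theorem theorem5p4:
  fixes A S :: "'a::complex_hilbert operator"
  assumes "infinite_dimensional TYPE('a)" and "separable_space (euclidean :: 'a topology)"
    and "selfadjoint_operator A" and "\<not> bounded_operator A"
    and "posdef_selfadjoint S"
    and "dom S \<inter> dom A = {0}"
  shows "\<exists>Sn :: nat \<Rightarrow> 'a operator.
    (\<forall>n. posdef_selfadjoint (Sn n)) \<and>
    (\<forall>n. dom (Sn n) = dom S + dom A) \<and>
    (\<forall>n. closure ((\<lambda>f. Sn n \<cdot> f) ` dom A) \<inter> dom (Sn n) = {0}) \<and>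
    (\<forall>n. dom (Sn n \<circ>\<^sub>m Sn n) \<inter> dom A = {0}) \<and>
    (\<forall>n. let L = orthocomplement (closure ((\<lambda>f. Sn n \<cdot> f) ` dom A)) in
       S = inverse_sqrt_operator
             (inverse_operator (Sn n) \<circ>\<^sub>m orthogonal_projection L \<circ>\<^sub>m inverse_operator (Sn n))) \<and>
    (\<forall>f \<in> dom S + dom A. incseq (\<lambda>n. norm (Sn n \<cdot> f))) \<and>
    dom S = {f \<in> dom S + dom A. bdd_above (range (\<lambda>n. norm (Sn n \<cdot> f)))} \<and>
    strong_resolvent_convergence Sn S"
proof -
  obtain B where B: "positive_map B" "inj B" and S: "S = inverse_operator (total_op B)"
    using posdef_obtain_inverse[OF assms(5)] by blast
  obtain C D where CD: "adjoint_pair C D" "bounded_map C" "bounded_map D"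
    and C_inj: "inj C" and ran_C: "range C = dom A"
    using selfadjoint_domain_eq_range[OF assms(3)] by blast
  have dom_S: "dom S = range B" unfolding S by (rule dom_inverse_total[OF B(2)])
  note Bh = positive_mapD(1)[OF B(1)]
  \<comment> \<open>Trivial intersection of the domains enters here, through
    \<open>B u = C (- v)\<close>.\<close>
  have triv: "u = 0 \<and> v = 0" if "B u + C v = 0" for u v
  proof -
    have "C (- v) = - C v"
      using adjoint_pair_diff[OF CD(1), of 0 v] by (simp add: adjoint_pair_0[OF CD(1)])
    then have "B u = C (- v)" using that by (metis eq_neg_iff_add_eq_0)
    then have "B u \<in> dom S \<inter> dom A" "C (- v) \<in> dom S \<inter> dom A"
      unfolding dom_S ran_C[symmetric] by (metis IntI rangeI)+
    then have "B u = B 0" "C (- v) = C 0"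
      using assms(6) by (auto simp: adjoint_pair_0[OF Bh] adjoint_pair_0[OF CD(1)])
    then show ?thesis using injD[OF B(2)] injD[OF C_inj] by (metis neg_equal_0_iff_equal)
  qed
  \<comment> \<open>The shift by one avoids division by zero at \<open>n = 0\<close>. The scaling
    leaves the range of \<open>C\<close> unchanged, while its square tends to
    \<open>0\<close>.\<close>
  define a where "a n = 1 / sqrt (real n + 1)" for n
  have a: "0 < a n" "(a n)\<^sup>2 = 1 / (real n + 1)" for n by (simp_all add: a_def power_divide)
  let ?C = "\<lambda>n x. a n *\<^sub>R C x" and ?D = "\<lambda>n x. a n *\<^sub>R D x"
  have CDn: "adjoint_pair (?C n) (?D n)" "bounded_map (?C n)" "bounded_map (?D n)" for n
    by (intro adjoint_pair_scaleR_map bounded_map_scaleR CD)+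
  have Cn_inv: "?C n ((1 / a n) *\<^sub>R v) = C v" for n v
    using a(1)[of n] by (simp add: adjoint_pair_scaleR[OF CD(1)])
  have K: "positive_map (\<lambda>x. B (B x) + ?C n (?D n x))" for n
    unfolding positive_map_def
  proof (intro conjI allI)
    show "hermitian (\<lambda>x. B (B x) + ?C n (?D n x))"
      using adjoint_pairD[OF Bh] adjoint_pairD[OF CDn(1)[of n]]
        adjoint_pairD[OF adjoint_pair_commute[OF CDn(1)[of n]]]
      by (simp add: adjoint_pair_def cinner_add_left cinner_add_right)
    show "bounded_map (\<lambda>x. B (B x) + ?C n (?D n x))"
      by (intro bounded_map_add bounded_map_compose[of B B] bounded_map_compose[of "?C n" "?D n"]
          CDn positive_mapD(2)[OF B(1)])
    fix x
    show "0 \<le> inner (B (B x) + ?C n (?D n x)) x"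
      using adjoint_pair_inner[OF Bh, of "B x" x] adjoint_pair_inner[OF CDn(1)[of n], of "?D n x" x]
      by (simp only: inner_add_left inner_ge_zero add_nonneg_nonneg)
  qed
  have "\<exists>T. positive_map T \<and> (\<forall>x. T (T x) = B (B x) + ?C n (?D n x))" for n
    using positive_sqrt_exists[OF K[of n]] by metis
  then obtain T where T: "\<And>n. positive_map (T n)"
    and TT: "\<And>n x. T n (T n x) = B (B x) + ?C n (?D n x)" by metis
  have "square_sum B (?C n) (?D n) (T n)" for n
  proof
    fix u v assume "B u + ?C n v = 0"
    then have "u = 0 \<and> a n *\<^sub>R v = 0"
      using triv[of u "a n *\<^sub>R v"] by (simp only: adjoint_pair_scaleR[OF CD(1)])
    then show "u = 0 \<and> v = 0" using a(1)[of n] by simp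
  qed (use T TT CDn positive_mapD[OF B(1)] in auto)
  then interpret Q: square_sum B "?C n" "?D n" "T n" for n .
  let ?S = "\<lambda>n. inverse_operator (total_op (T n))"
  have Q_S: "Q.S n = ?S n" for n by (rule Q.S_def)
  have ran: "range (?C n) = dom A" for n
  proof -
    have "?C n v \<in> range C" for v
      using adjoint_pair_scaleR[OF CD(1), of "a n" v] by (metis rangeI)
    moreover have "C v \<in> range (?C n)" for v using Cn_inv[of n v] by (metis rangeI)
    ultimately show ?thesis unfolding ran_C[symmetric] by blast
  qed
  have dom: "dom (?S n) = dom S + dom A" for n
    using Q.dom_S[of n] unfolding Q_S ran dom_S .
  have N: "closure ((\<lambda>f. ?S n \<cdot> f) ` dom A) = Q.N n" for n
    using Q.closure_N[of n] unfolding Q.N_def Q_S ran .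
  \<comment> \<open>Relative to the scaled map, \<open>C v\<close> has the component
    \<open>v\<close> divided by \<open>a n\<close>, whence the factor
    \<open>real n + 1\<close>.\<close>
  have norm: "(norm (?S n \<cdot> (B u + C v)))\<^sup>2 = (norm u)\<^sup>2 + (real n + 1) * (norm v)\<^sup>2" for n u v
  proof -
    have "(norm (?S n \<cdot> (B u + C v)))\<^sup>2 = (norm u)\<^sup>2 + (norm ((1 / a n) *\<^sub>R v))\<^sup>2"
      using Q.norm_S[of n u "(1 / a n) *\<^sub>R v"] unfolding Cn_inv Q_S .
    then show ?thesis by (simp add: power_divide a)
  qed
  have sum_cases: "\<exists>u v. f = B u + C v" if "f \<in> dom S + dom A" for f
    using that unfolding dom_S ran_C[symmetric] by (auto simp: set_plus_def)
  show ?thesis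
  proof (intro exI[of _ ?S] conjI allI ballI)
    fix n
    show "posdef_selfadjoint (?S n)" by (rule posdef_inverse_total[OF T Q.inj_T])
    show "dom (?S n) = dom S + dom A" by (rule dom)
    show "closure ((\<lambda>f. ?S n \<cdot> f) ` dom A) \<inter> dom (?S n) = {0}"
      using Q.N_inter_dom[of n] unfolding N Q_S .
    show "dom (?S n \<circ>\<^sub>m ?S n) \<inter> dom A = {0}"
      using Q.dom_square_inter[of n] unfolding Q_S ran .
    show "let L = orthocomplement (closure ((\<lambda>f. ?S n \<cdot> f) ` dom A)) in
       S = inverse_sqrt_operator
             (inverse_operator (?S n) \<circ>\<^sub>m orthogonal_projection L \<circ>\<^sub>m inverse_operator (?S n))"
      \<comment> \<open>The compressed product is the square of \<open>B\<close>; its root is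
        \<open>B\<close>, whose inverse is \<open>S\<close>.\<close>
      unfolding Let_def N Q.compression[of n, unfolded Q_S] inverse_sqrt_operator_def
        sqrt_operator_total[OF B(1)] by (rule S)
  next
    fix f assume "f \<in> dom S + dom A"
    then obtain u v where f: "f = B u + C v" using sum_cases by blast
    show "incseq (\<lambda>n. norm (?S n \<cdot> f))"
    proof (rule incseq_SucI)
      fix n
      have "(norm (?S n \<cdot> f))\<^sup>2 \<le> (norm (?S (Suc n) \<cdot> f))\<^sup>2"
        unfolding f norm by (intro add_left_mono mult_right_mono) auto
      then show "norm (?S n \<cdot> f) \<le> norm (?S (Suc n) \<cdot> f)" by (rule power2_le_imp_le) simp
    qed
  next
    show "dom S = {f \<in> dom S + dom A. bdd_above (range (\<lambda>n. norm (?S n \<cdot> f)))}" (is "_ = ?R")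
    proof (intro equalityI subsetI)
      fix f assume "f \<in> dom S"
      then obtain u where u: "f = B u + C 0"
        unfolding dom_S by (auto simp: adjoint_pair_0[OF CD(1)])
      have "norm (?S n \<cdot> f) \<le> norm u" for n
        by (rule power2_le_imp_le) (simp_all add: u norm)
      then have "bdd_above (range (\<lambda>n. norm (?S n \<cdot> f)))" by (rule bdd_aboveI2)
      moreover have "f \<in> dom S + dom A"
        unfolding u dom_S ran_C[symmetric] by (intro set_plus_intro rangeI)
      ultimately show "f \<in> ?R" by blast
    next
      fix f assume "f \<in> ?R"
      then obtain u v M where f: "f = B u + C v" and M: "\<And>n. norm (?S n \<cdot> f) \<le> M"
        using sum_cases unfolding bdd_above_def by blast
      \<comment> \<open>A bound uniform in \<open>n\<close> forces \<open>v = 0\<close>, so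
        \<open>f\<close> reduces to \<open>B u\<close>.\<close>
      have "real n * (norm v)\<^sup>2 \<le> M\<^sup>2" for n
      proof -
        have "real n * (norm v)\<^sup>2 \<le> (norm (?S n \<cdot> f))\<^sup>2"
          unfolding f norm by (simp add: distrib_right)
        also have "\<dots> \<le> M\<^sup>2" by (intro power_mono M) simp
        finally show ?thesis .
      qed
      then have "\<not> 0 < (norm v)\<^sup>2" using reals_Archimedean3 by (metis not_le)
      then have "v = 0" by simp
      then show "f \<in> dom S" unfolding f dom_S by (simp add: adjoint_pair_0[OF CD(1)])
    qed
  next
    obtain c where c: "0 < c" "\<And>x. norm (C (D x)) \<le> c * norm x"
      using bounded_map_compose[OF CD(2,3)] by (meson bounded_mapE)
    have "(\<lambda>n. T n x) \<longlonglongrightarrow> B x" for x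
    proof (rule LIM_zero_cancel, rule Lim_null_comparison)
      \<comment> \<open>The squares differ by \<open>(a n)\<^sup>2\<close> times a fixed bounded
        map, so \<open>positive_diff_le_sqrt\<close> gives norm convergence of the roots.\<close>
      have "norm (T n (T n x) - B (B x)) \<le> (c * (a n)\<^sup>2) * norm x" for n x
      proof -
        have "T n (T n x) - B (B x) = (a n)\<^sup>2 *\<^sub>R C (D x)"
          by (simp add: TT adjoint_pair_scaleR[OF CD(1)] power2_eq_square)
        then show ?thesis
          using mult_left_mono[OF c(2)[of x], of "(a n)\<^sup>2"] by (simp add: mult_ac)
      qed
      then have "norm (T n x - B x) \<le> sqrt (c * (a n)\<^sup>2) * norm x" for n
        using c(1) by (intro positive_diff_le_sqrt[OF T B(1)]) auto
      then show "\<forall>\<^sub>F n in sequentially. norm (T n x - B x) \<le> sqrt (c * (a n)\<^sup>2) * norm x" by simp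
      have "(\<lambda>n. (a n)\<^sup>2) \<longlonglongrightarrow> 0"
        using LIMSEQ_inverse_real_of_nat by (simp add: a inverse_eq_divide add.commute)
      then have "(\<lambda>n. sqrt (c * (a n)\<^sup>2) * norm x) \<longlonglongrightarrow> sqrt (c * 0) * norm x"
        by (intro tendsto_intros)
      then show "(\<lambda>n. sqrt (c * (a n)\<^sup>2) * norm x) \<longlonglongrightarrow> 0" by simp
    qed
    then show "strong_resolvent_convergence ?S S"
      unfolding S
      by (intro strong_resolvent_convergence_inverse positive_mapD(1)[OF T] Q.inj_T Bh B(2))
  qed
qed

end
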